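(* Suppose strong duality holds for the pair of semidefinite programs (P) and (D). Let $r_p\ge 0$, $r_c\ge 1$, $\bar r=r_p+r_c$, $\beta\in(0,1)$, $\rho>0$, $\alpha\ge 2D_{\mathcal X_\star}$, $V_0\in\mathbb R^{n\times\bar r}$ (with orthonormal columns), and $z_0=y_0\in\mathbb R^m$ be given, and run $(r_p,r_c)$-SpecBM with these data. Then there is a constant $K$, independent of $\epsilon$, such that for every target accuracy $\epsilon\in(0,\tfrac12)$ there is an iteration $t\le K/\epsilon^{3}$ (that is, $t\le\mathcal O(1/\epsilon^3)$) at which the pair $(X_t,y_t)$ produced by the method satisfies $F(y_t)-F(y_\star)\le\epsilon$ (where $y_\star\in\mathcal Y_\star$) and 1. approximate primal feasibility: $\|b-\mathcal A X_t\|^2\le\epsilon$ and $X_t\succeq 0$; 2. approximate dual feasibility: $\lambda_{\min}(C-\mathcal A^*y_t)\ge-\epsilon$; 3. approximate primal-dual optimality: $|\langle b,y_t\rangle-\langle C,X_t\rangle|\le\sqrt{\epsilon}$. Moreover, if additionally strict complementarity holds, then there is a constant $K'$, independent of $\epsilon$, such that for every $\epsilon\in(0,\tfrac12)$ all these conditions are reached at some iteration $t\le K'/\epsilon$ (that is, $t\le\mathcal O(1/\epsilon)$).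
   Context: **SDP pair.** $\mathbb S^n$ is the space of real symmetric $n\times n$ matrices with the trace inner product, $\mathbb S^n_+$ its positive semidefinite cone, and $\mathbb R^m$ carries the dot product; $\|\cdot\|$ denotes the induced norms. Given $C\in\mathbb S^n$, a linear map $\mathcal A:\mathbb S^n\to\mathbb R^m$ with adjoint $\mathcal A^*$, and $b\in\mathbb R^m$, consider (P): maximize $\langle -C,X\rangle$ subject to $\mathcal AX=b$, $X\succeq0$, $X\in\mathbb S^n$; (D): minimize $\langle -b,y\rangle$ subject to $\mathcal A^*y\preceq C$, $y\in\mathbb R^m$. Their solution sets are $\mathcal X_\star$ and $\mathcal Y_\star$. *Strong duality* means: $\mathcal X_\star,\mathcal Y_\star$ are nonempty and compact and $\langle -C,X_\star\rangle=\langle -b,y_\star\rangle$ for all $X_\star\in\mathcal X_\star$, $y_\star\in\mathcal Y_\star$. *Strict complementarity* means: there is $(X_\star,y_\star)\in\mathcal X_\star\times\mathcal Y_\star$ with $\operatorname{rank}(X_\star)+\operatorname{rank}(C-\mathcal A^*y_\star)=n$. Let $D_{\mathcal X_\star}=\sup_{X_\star\in\mathcal X_\star}\|X_\star\|_*$ (nuclear norm). **Penalized dual.** $F(y)=\langle -b,y\rangle+\alpha\max\{\lambda_{\max}(\mathcal A^*y-C),0\}$, where the penalty parameter $\alpha$ is larger than $\sup_{X_\star\in\mathcal X_\star}\operatorname{tr}(X_\star)$ (so that minimizing $F$ has the same optimal value and solution set as (D)). **The method $(r_p,r_c)$-SpecBM.** Parameters: integers $r_p\ge0$, $r_c\ge1$,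 $\bar r=r_p+r_c$; $\rho>0$, $\beta$, $\alpha$. Initialize $\bar X_0=0\in\mathbb S^n$, $z_0=y_0\in\mathbb R^m$, and $V_0\in\mathbb R^{n\times\bar r}$ with orthonormal columns. The spectral model at iteration $t$ is $$\bar F_t(y)=\max_{\eta\ge0,\ S\in\mathbb S^{\bar r}_+,\ \eta\operatorname{tr}(\bar X_t)+\operatorname{tr}(S)\le\alpha}\ \langle -b,y\rangle+\langle \eta\bar X_t+V_tSV_t^\top,\mathcal A^*y-C\rangle .$$ Iteration $t=0,1,2,\dots$: (1) Compute a solution $z_{t+1}=z_t^\star$, $(\eta_t^\star,S_t^\star)$ of the minimax (saddle-point) problem $$\min_z\ \max_{\eta\ge0,\ S\in\mathbb S^{\bar r}_+,\ \eta\operatorname{tr}(\bar X_t)+\operatorname{tr}(S)\le\alpha}\ \langle -b,z\rangle+\langle \eta\bar X_t+V_tSV_t^\top,\mathcal A^*z-C\rangle+\tfrac{\rho}{2}\|z-y_t\|^2,$$ and define the primal iterate $X_t=\eta_t^\star\bar X_t+V_tS_t^\star V_t^\top$. (2) If $\beta\,(F(y_t)-\bar F_t(z_{t+1}))\le F(y_t)-F(z_{t+1})$, set $y_{t+1}=z_{t+1}$ (descent step); otherwise set $y_{t+1}=y_t$ (null step). (3) Write the eigenvalue decomposition $S_t^\star=Q_1\Lambda_1Q_1^\top+Q_2\Lambda_2Q_2^\top$, where $\Lambda_1$ contains the $r_p$ largest eigenvalues and $\Lambda_2$ the rest, and set $\bar X_{t+1}=\eta_t^\star\bar X_t+V_tQ_2\Lambda_2Q_2^\top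 V_t^\top$. (4) Compute $r_c$ orthonormal top eigenvectors $v_1,\dots,v_{r_c}$ of $\mathcal A^*z_{t+1}-C$, and let $V_{t+1}\in\mathbb R^{n\times\bar r}$ have orthonormal columns whose span contains $v_1,\dots,v_{r_c}$ and the columns of $V_tQ_1$. *)

theory Defs
  imports "HOL-Analysis.Analysis"
begin

subsection \<open>Symmetric matrices\<close>

text \<open>The inner product of the type \<^typ>\<open>real^'n^'n\<close> is the sum of the entrywise
  products, which on symmetric matrices is the trace inner product.\<close>

definition sym_mats :: "(real^'n^'n) set" where
  "sym_mats = {X. transpose X = X}"

definition psd :: "real^'n^'n \<Rightarrow> bool" where
  "psd X \<longleftrightarrow> X \<in> sym_mats \<and> (\<forall>v. 0 \<le> v \<bullet> (X *v v))"

definition loewner_le :: "real^'n^'n \<Rightarrow> real^'n^'n \<Rightarrow> bool" (infix "\<preceq>\<^sub>L" 50) where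
  "X \<preceq>\<^sub>L Y \<longleftrightarrow> psd (Y - X)"

definition eigenvalues :: "real^'n^'n \<Rightarrow> real set" where
  "eigenvalues M = {l. \<exists>v. v \<noteq> 0 \<and> M *v v = l *\<^sub>R v}"

definition lambda_max :: "real^'n^'n \<Rightarrow> real" where
  "lambda_max M = Max (eigenvalues M)"

definition lambda_min :: "real^'n^'n \<Rightarrow> real" where
  "lambda_min M = Min (eigenvalues M)"

text \<open>The sum of the singular values, that is, of the square roots of the eigenvalues of
  \<open>X\<^sup>T X\<close>, each counted with its multiplicity.\<close>

definition nuclear_norm :: "real^'n^'n \<Rightarrow> real" where
  "nuclear_norm X =
     (\<Sum>l\<in>eigenvalues (transpose X ** X).
        real (dim {v. (transpose X ** X) *v v = l *\<^sub>R v}) * sqrt l)"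

definition diag_mat :: "('r \<Rightarrow> real) \<Rightarrow> real^'r^'r" where
  "diag_mat d = (\<chi> i j. if i = j then d i else 0)"

definition eigen_decomp :: "real^'r^'r \<Rightarrow> real^'r^'r \<Rightarrow> ('r \<Rightarrow> real) \<Rightarrow> bool" where
  "eigen_decomp M Q d \<longleftrightarrow> orthogonal_matrix Q \<and> M = Q ** diag_mat d ** transpose Q"

text \<open>The index set \<open>I\<close> selects the \<open>k\<close> largest of the values \<open>d i\<close>, counted with multiplicity;
  ties at the boundary may be broken in any way.\<close>

definition top_indices :: "('r::finite \<Rightarrow> real) \<Rightarrow> nat \<Rightarrow> 'r set \<Rightarrow> bool" where
  "top_indices d k I \<longleftrightarrow> card I = k \<and> (\<forall>i\<in>I. \<forall>j\<in>- I. d j \<le> d i)"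

definition orthonormal_columns :: "real^'r^'n \<Rightarrow> bool" where
  "orthonormal_columns V \<longleftrightarrow> transpose V ** V = mat 1"

subsection \<open>The pair of semidefinite programs\<close>

text \<open>Linearity, and the adjoint, of a map from the space of symmetric matrices to \<open>\<real>\<^sup>m\<close>.
  Such a map is given by a function on all matrices, of which only the values on symmetric
  matrices matter; the library's \<^const>\<open>adjoint\<close> would take its values in the space of
  all matrices.\<close>

definition linear_on_sym :: "(real^'n^'n \<Rightarrow> real^'m) \<Rightarrow> bool" where
  "linear_on_sym A \<longleftrightarrow>
     (\<forall>X\<in>sym_mats. \<forall>Y\<in>sym_mats. A (X + Y) = A X + A Y) \<and>
     (\<forall>c. \<forall>X\<in>sym_mats. A (c *\<^sub>R X) = c *\<^sub>R A X)"

definition sym_adjoint :: "(real^'n^'n \<Rightarrow> real^'m) \<Rightarrow> real^'m \<Rightarrow> real^'n^'n" where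
  "sym_adjoint A =
     (SOME f. \<forall>y. f y \<in> sym_mats \<and> (\<forall>X\<in>sym_mats. A X \<bullet> y = X \<bullet> f y))"

lemma inner_transpose: "transpose X \<bullet> transpose Y = X \<bullet> (Y :: real^'n^'n)"
  unfolding inner_vec_def transpose_def by (simp, subst sum.swap) simp

lemma sym_adjoint_works:
  fixes A :: "real^'n^'n \<Rightarrow> real^'m"
  assumes "linear_on_sym A"
  shows "sym_adjoint A y \<in> sym_mats \<and> (\<forall>X\<in>sym_mats. A X \<bullet> y = X \<bullet> sym_adjoint A y)"
proof -
  define sp :: "real^'n^'n \<Rightarrow> real^'n^'n" where "sp X = (1/2) *\<^sub>R (X + transpose X)" for X
  have tr_add: "transpose (X + Y) = transpose X + transpose Y" for X Y :: "real^'n^'n"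
    by (simp add: transpose_def vec_eq_iff)
  have tr_sc: "transpose (c *\<^sub>R X) = c *\<^sub>R transpose X" for c and X :: "real^'n^'n"
    by (simp add: transpose_def vec_eq_iff)
  have sp_sym: "sp X \<in> sym_mats" for X
    by (simp add: sp_def sym_mats_def tr_add tr_sc add.commute)
  have sp_id: "sp X = X" if "X \<in> sym_mats" for X
    using that by (simp add: sp_def sym_mats_def flip: scaleR_2)
  have lin: "linear (\<lambda>X. A (sp X))"
  proof (rule linearI)
    fix X Y :: "real^'n^'n" and c :: real
    have "sp (X + Y) = sp X + sp Y" by (simp add: sp_def tr_add algebra_simps)
    then show "A (sp (X + Y)) = A (sp X) + A (sp Y)"
      using assms sp_sym by (simp add: linear_on_sym_def)
    have "sp (c *\<^sub>R X) = c *\<^sub>R sp X" by (simp add: sp_def tr_sc algebra_simps)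
    then show "A (sp (c *\<^sub>R X)) = c *\<^sub>R A (sp X)"
      using assms sp_sym by (simp add: linear_on_sym_def)
  qed
  define f where "f y = sp (adjoint (\<lambda>X. A (sp X)) y)" for y
  have "A X \<bullet> y = X \<bullet> f y" if X: "X \<in> sym_mats" for X y
  proof -
    let ?Z = "adjoint (\<lambda>X. A (sp X)) y"
    have "X \<bullet> transpose ?Z = X \<bullet> ?Z"
      using X inner_transpose[of X ?Z] by (simp add: sym_mats_def)
    then have "X \<bullet> f y = X \<bullet> ?Z"
      by (simp add: f_def sp_def inner_add_right)
    also have "\<dots> = A (sp X) \<bullet> y" by (rule adjoint_works[OF lin])
    finally show ?thesis using sp_id[OF X] by simp
  qed
  then have "\<exists>f. \<forall>y. f y \<in> sym_mats \<and> (\<forall>X\<in>sym_mats. A X \<bullet> y = X \<bullet> f y)"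
    using sp_sym f_def by metis
  from someI_ex[OF this] show ?thesis unfolding sym_adjoint_def by (rule spec)
qed

definition primal_feasible ::
  "(real^'n^'n \<Rightarrow> real^'m) \<Rightarrow> real^'m \<Rightarrow> (real^'n^'n) set" where
  "primal_feasible A b = {X. A X = b \<and> psd X}"

definition primal_solutions ::
  "real^'n^'n \<Rightarrow> (real^'n^'n \<Rightarrow> real^'m) \<Rightarrow> real^'m \<Rightarrow> (real^'n^'n) set" where
  "primal_solutions C A b =
     {X \<in> primal_feasible A b. \<forall>X'\<in>primal_feasible A b. (- C) \<bullet> X' \<le> (- C) \<bullet> X}"

definition dual_feasible ::
  "real^'n^'n \<Rightarrow> (real^'n^'n \<Rightarrow> real^'m) \<Rightarrow> (real^'m) set" where
  "dual_feasible C A = {y. sym_adjoint A y \<preceq>\<^sub>L C}"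

definition dual_solutions ::
  "real^'n^'n \<Rightarrow> (real^'n^'n \<Rightarrow> real^'m) \<Rightarrow> real^'m \<Rightarrow> (real^'m) set" where
  "dual_solutions C A b =
     {y \<in> dual_feasible C A. \<forall>y'\<in>dual_feasible C A. (- b) \<bullet> y \<le> (- b) \<bullet> y'}"

definition strong_duality ::
  "real^'n^'n \<Rightarrow> (real^'n^'n \<Rightarrow> real^'m) \<Rightarrow> real^'m \<Rightarrow> bool" where
  "strong_duality C A b \<longleftrightarrow>
     primal_solutions C A b \<noteq> {} \<and> compact (primal_solutions C A b) \<and>
     dual_solutions C A b \<noteq> {} \<and> compact (dual_solutions C A b) \<and>
     (\<forall>X\<in>primal_solutions C A b. \<forall>y\<in>dual_solutions C A b. (- C) \<bullet> X = (- b) \<bullet> y)"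

definition strict_complementarity ::
  "real^'n^'n \<Rightarrow> (real^'n^'n \<Rightarrow> real^'m) \<Rightarrow> real^'m \<Rightarrow> bool" where
  "strict_complementarity C A b \<longleftrightarrow>
     (\<exists>X\<in>primal_solutions C A b. \<exists>y\<in>dual_solutions C A b.
        rank X + rank (C - sym_adjoint A y) = CARD('n))"

definition primal_radius ::
  "real^'n^'n \<Rightarrow> (real^'n^'n \<Rightarrow> real^'m) \<Rightarrow> real^'m \<Rightarrow> real" where
  "primal_radius C A b = (SUP X\<in>primal_solutions C A b. nuclear_norm X)"

definition penalized_dual ::
  "real^'n^'n \<Rightarrow> (real^'n^'n \<Rightarrow> real^'m) \<Rightarrow> real^'m \<Rightarrow> real \<Rightarrow> real^'m \<Rightarrow> real" where
  "penalized_dual C A b \<alpha> y = (- b) \<bullet> y + \<alpha> * max (lambda_max (sym_adjoint A y - C)) 0"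

subsection \<open>The spectral bundle method\<close>

definition model_set :: "real \<Rightarrow> real^'n^'n \<Rightarrow> (real \<times> (real^'r^'r)) set" where
  "model_set \<alpha> Xbar = {(\<eta>, S). 0 \<le> \<eta> \<and> psd S \<and> \<eta> * trace Xbar + trace S \<le> \<alpha>}"

definition model_matrix ::
  "real^'n^'n \<Rightarrow> real^'r^'n \<Rightarrow> real \<times> (real^'r^'r) \<Rightarrow> real^'n^'n" where
  "model_matrix Xbar V = (\<lambda>(\<eta>, S). \<eta> *\<^sub>R Xbar + V ** S ** transpose V)"

definition spectral_model ::
  "real^'n^'n \<Rightarrow> (real^'n^'n \<Rightarrow> real^'m) \<Rightarrow> real^'m \<Rightarrow> real \<Rightarrow>
   real^'n^'n \<Rightarrow> real^'r^'n \<Rightarrow> real^'m \<Rightarrow> real" where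
  "spectral_model C A b \<alpha> Xbar V y =
     (SUP p\<in>model_set \<alpha> Xbar. (- b) \<bullet> y + model_matrix Xbar V p \<bullet> (sym_adjoint A y - C))"

definition prox_lagrangian ::
  "real^'n^'n \<Rightarrow> (real^'n^'n \<Rightarrow> real^'m) \<Rightarrow> real^'m \<Rightarrow> real \<Rightarrow>
   real^'n^'n \<Rightarrow> real^'r^'n \<Rightarrow> real^'m \<Rightarrow> real^'m \<Rightarrow> real \<times> (real^'r^'r) \<Rightarrow> real" where
  "prox_lagrangian C A b \<rho> Xbar V y z p =
     (- b) \<bullet> z + model_matrix Xbar V p \<bullet> (sym_adjoint A z - C) + \<rho> / 2 * (norm (z - y))\<^sup>2"

definition saddle_point ::
  "real^'n^'n \<Rightarrow> (real^'n^'n \<Rightarrow> real^'m) \<Rightarrow> real^'m \<Rightarrow> real \<Rightarrow> real \<Rightarrow>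
   real^'n^'n \<Rightarrow> real^'r^'n \<Rightarrow> real^'m \<Rightarrow> real^'m \<Rightarrow> real \<times> (real^'r^'r) \<Rightarrow> bool" where
  "saddle_point C A b \<rho> \<alpha> Xbar V y z p \<longleftrightarrow>
     p \<in> model_set \<alpha> Xbar \<and>
     (\<forall>q\<in>model_set \<alpha> Xbar.
        prox_lagrangian C A b \<rho> Xbar V y z q \<le> prox_lagrangian C A b \<rho> Xbar V y z p) \<and>
     (\<forall>w. prox_lagrangian C A b \<rho> Xbar V y z p \<le> prox_lagrangian C A b \<rho> Xbar V y w p)"

text \<open>The splitting \<open>S = Q\<^sub>1 \<Lambda>\<^sub>1 Q\<^sub>1\<^sup>T + Q\<^sub>2 \<Lambda>\<^sub>2 Q\<^sub>2\<^sup>T\<close> is written with one orthogonal matrix \<open>Q\<close>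
  and a set \<open>I\<close> of \<open>rp\<close> column indices: \<open>Q\<^sub>1\<close> consists of the columns of \<open>Q\<close> indexed by \<open>I\<close>, and
  \<open>Q\<^sub>2\<close> of the others. In the same way the columns of \<open>W\<close> indexed by \<open>J\<close> are the \<open>rc\<close> orthonormal
  top eigenvectors of \<open>A\<^sup>* z - C\<close>.\<close>

definition bundle_update ::
  "real^'n^'n \<Rightarrow> (real^'n^'n \<Rightarrow> real^'m) \<Rightarrow> nat \<Rightarrow> nat \<Rightarrow>
   real^'n^'n \<Rightarrow> real^'r^'n \<Rightarrow> real^'m \<Rightarrow> real \<times> (real^'r^'r) \<Rightarrow>
   real^'n^'n \<Rightarrow> real^'r^'n \<Rightarrow> bool" where
  "bundle_update C A rp rc Xbar V z p Xbar' V' \<longleftrightarrow>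
     (\<exists>Q d I W \<mu> J.
        eigen_decomp (snd p) Q d \<and> top_indices d rp I \<and>
        Xbar' = fst p *\<^sub>R Xbar +
          V ** (Q ** diag_mat (\<lambda>i. if i \<in> I then 0 else d i) ** transpose Q) ** transpose V \<and>
        eigen_decomp (sym_adjoint A z - C) W \<mu> \<and> top_indices \<mu> rc J \<and>
        orthonormal_columns V' \<and>
        (\<lambda>j. column j W) ` J \<union> (\<lambda>i. column i (V ** Q)) ` I \<subseteq> span (columns V'))"

text \<open>The sequences \<open>y\<close>, \<open>z\<close>, \<open>Xbar\<close>, \<open>V\<close>, \<open>p\<close> and \<open>X\<close> form a run of the method, where
  \<open>p t\<close> is the pair \<open>(\<eta>\<^sub>t\<^sup>*, S\<^sub>t\<^sup>*)\<close>. The method is not deterministic: solutions of the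
  subproblem, eigenvectors and the new basis may be chosen freely.\<close>

definition specbm_run ::
  "real^'n^'n \<Rightarrow> (real^'n^'n \<Rightarrow> real^'m) \<Rightarrow> real^'m \<Rightarrow>
   nat \<Rightarrow> nat \<Rightarrow> real \<Rightarrow> real \<Rightarrow> real \<Rightarrow> real^'r^'n \<Rightarrow> real^'m \<Rightarrow>
   (nat \<Rightarrow> real^'m) \<Rightarrow> (nat \<Rightarrow> real^'m) \<Rightarrow> (nat \<Rightarrow> real^'n^'n) \<Rightarrow> (nat \<Rightarrow> real^'r^'n) \<Rightarrow>
   (nat \<Rightarrow> real \<times> (real^'r^'r)) \<Rightarrow> (nat \<Rightarrow> real^'n^'n) \<Rightarrow> bool" where
  "specbm_run C A b rp rc \<beta> \<rho> \<alpha> V0 y0 y z Xbar V p X \<longleftrightarrow>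
     y 0 = y0 \<and> z 0 = y0 \<and> Xbar 0 = 0 \<and> V 0 = V0 \<and>
     (\<forall>t. saddle_point C A b \<rho> \<alpha> (Xbar t) (V t) (y t) (z (Suc t)) (p t) \<and>
          X t = model_matrix (Xbar t) (V t) (p t) \<and>
          y (Suc t) =
            (if \<beta> * (penalized_dual C A b \<alpha> (y t)
                       - spectral_model C A b \<alpha> (Xbar t) (V t) (z (Suc t)))
                \<le> penalized_dual C A b \<alpha> (y t) - penalized_dual C A b \<alpha> (z (Suc t))
             then z (Suc t) else y t) \<and>
          bundle_update C A rp rc (Xbar t) (V t) (z (Suc t)) (p t) (Xbar (Suc t)) (V (Suc t)))"

definition eps_optimal_pair ::
  "real^'n^'n \<Rightarrow> (real^'n^'n \<Rightarrow> real^'m) \<Rightarrow> real^'m \<Rightarrow> real \<Rightarrow> real \<Rightarrow>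
   real^'n^'n \<Rightarrow> real^'m \<Rightarrow> bool" where
  "eps_optimal_pair C A b \<alpha> \<epsilon> X y \<longleftrightarrow>
     (\<forall>y'\<in>dual_solutions C A b. penalized_dual C A b \<alpha> y - penalized_dual C A b \<alpha> y' \<le> \<epsilon>) \<and>
     (norm (b - A X))\<^sup>2 \<le> \<epsilon> \<and> psd X \<and>
     lambda_min (C - sym_adjoint A y) \<ge> - \<epsilon> \<and>
     \<bar>b \<bullet> y - C \<bullet> X\<bar> \<le> sqrt \<epsilon>"

end

theory Submission
  imports Defs
begin

text \<open>
  Write \<open>F\<^sup>*\<close> for the optimal value, \<open>\<delta>\<^sub>t = F(y\<^sub>t) - F\<^sup>*\<close> for the objective gap, and let \<open>\<Delta>\<^sub>t\<close> be
  \<open>F(y\<^sub>t)\<close> minus the saddle value of the proximal subproblem at iteration \<open>t\<close>. At an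
  iteration where both are small, everything in the conclusion holds: the optimality
  condition of the subproblem in \<open>z\<close> gives \<open>b - \<A> X\<^sub>t = \<rho> (z\<^sub>t\<^sub>+\<^sub>1 - y\<^sub>t)\<close>, whose square is at
  most \<open>2 \<rho> \<Delta>\<^sub>t\<close>; the exact penalty bounds the violation of the dual constraint by a multiple of
  \<open>\<delta>\<^sub>t\<close>; and the primal-dual gap is a sum of terms of order \<open>\<delta>\<^sub>t\<close>, \<open>\<Delta>\<^sub>t\<close> and
  \<open>\<parallel>b - \<A> X\<^sub>t\<parallel>\<close>, which explains the square root in the third condition (lemma
  \<open>eps_optimal_if_small\<close>).

  Three inequalities drive the iteration count. A descent step lowers \<open>\<delta>\<^sub>t\<close> by at least
  \<open>\<beta> \<Delta>\<^sub>t\<close>. A null step keeps \<open>\<delta>\<^sub>t\<close> and satisfies \<open>\<Delta>\<^sub>t\<^sub>+\<^sub>1 \<le> \<Delta>\<^sub>t - c \<Delta>\<^sub>t\<^sup>2\<close>: the next model contains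
  the segment from \<open>X\<^sub>t\<close> to a multiple \<open>W\<close> of a top eigenprojection, and on this segment the
  concave quadratic dual function of the subproblem rises, initially with slope equal to the model
  error at \<open>z\<^sub>t\<^sub>+\<^sub>1\<close>, which is a fixed fraction of \<open>\<Delta>\<^sub>t\<close> or more when a step is rejected (lemmas \<open>cut_in_next_model\<close>,
  \<open>null_step_gain\<close>). Finally \<open>\<Delta>\<^sub>t \<ge> \<kappa> \<delta>\<^sub>t\<^sup>k\<close>, by comparing the proximal minimum with points on the segment
  from \<open>y\<^sub>t\<close> to a dual solution: \<open>k = 2\<close> holds because sublevel sets of \<open>F\<close> are bounded, and
  \<open>k = 1\<close> holds if \<open>F\<close> grows quadratically away from the dual solutions. A potential-function
  argument (lemma \<open>bundle_rate\<close>) turns the three inequalities into the bound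
  \<open>O(\<epsilon>\<^sup>-\<^sup>(\<^sup>2\<^sup>k\<^sup>-\<^sup>1\<^sup>))\<close>, that is \<open>\<epsilon>\<^sup>-\<^sup>3\<close> and \<open>\<epsilon>\<^sup>-\<^sup>1\<close>.

  Quadratic growth under strict complementarity (theorem \<open>quadratic_growth\<close>) is elementary. Let
  \<open>X\<close>, \<open>y\<^sub>*\<close> be a strictly complementary pair and \<open>Z(y) = C - \<A>\<^sup>* y\<close>. A gap \<open>\<epsilon>\<close> at \<open>y\<close> forces
  \<open>\<parallel>Z(y) X\<parallel> = O(\<epsilon>\<^sup>1\<^sup>/\<^sup>2)\<close>, so \<open>y\<close> lies within \<open>O(\<epsilon>\<^sup>1\<^sup>/\<^sup>2)\<close> of the affine space \<open>Z(y) X = 0\<close>. On that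
  space the objective is already optimal, and since \<open>Z(y\<^sub>*)\<close> is positive definite on the complement
  of the range of \<open>X\<close>, moving by \<open>O(\<epsilon>\<^sup>1\<^sup>/\<^sup>2)\<close> towards \<open>y\<^sub>*\<close> restores feasibility.
\<close>

section \<open>Symmetric and positive semidefinite matrices\<close>

definition outer :: "real^'n \<Rightarrow> real^'m \<Rightarrow> real^'m^'n" where
  "outer v w = (\<chi> i j. v $ i * w $ j)"

lemma outer_mult_vec: "outer v w *v x = (w \<bullet> x) *\<^sub>R v"
  by (simp add: outer_def vec_eq_iff matrix_vector_mult_def inner_vec_def sum_distrib_left
      sum_distrib_right mult_ac)

lemma inner_outer: "outer v w \<bullet> M = v \<bullet> (M *v w)"
  by (simp add: outer_def matrix_vector_mult_def inner_vec_def sum_distrib_left mult_ac)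

lemma norm_outer: "norm (outer v w) = norm v * norm w"
proof -
  have "(norm (outer v w))\<^sup>2 = (norm v * norm w)\<^sup>2"
    by (simp add: power2_norm_eq_inner inner_outer outer_mult_vec power_mult_distrib)
  then show ?thesis by (simp add: power2_eq_iff_nonneg)
qed

lemma trace_outer: "trace (outer v v) = v \<bullet> v"
  by (simp add: trace_def outer_def inner_vec_def)

lemma mult_outer: "M ** outer v w = outer (M *v v) w"
  by (simp add: outer_def matrix_matrix_mult_def matrix_vector_mult_def vec_eq_iff
      sum_distrib_left sum_distrib_right mult_ac)

lemma outer_mult_transpose: "outer v w ** transpose M = outer v (M *v w)"
  by (simp add: outer_def matrix_matrix_mult_def matrix_vector_mult_def vec_eq_iff transpose_def
      sum_distrib_left sum_distrib_right mult_ac)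

lemma transpose_outer: "transpose (outer v w) = outer w v"
  by (simp add: outer_def transpose_def vec_eq_iff mult.commute)

lemma trace_scaleR: "trace (c *\<^sub>R X) = c * trace (X :: real^'n^'n)"
  by (simp add: trace_def sum_distrib_left)

lemma trace_eq_inner: "trace X = X \<bullet> (mat 1 :: real^'n^'n)"
  by (simp add: trace_def inner_vec_def mat_def if_distrib sum.delta cong: if_cong)

lemma transpose_add: "transpose (X + Y) = transpose X + transpose (Y :: real^'n^'m)"
  by (simp add: transpose_def vec_eq_iff)

lemma matrix_add_rdistrib: "(X + Y) ** M = X ** M + (Y :: real^'n^'m) ** M"
  by (simp add: matrix_matrix_mult_def vec_eq_iff sum.distrib algebra_simps)

lemma matrix_scaleR_left: "(c *\<^sub>R X) ** M = c *\<^sub>R ((X :: real^'n^'m) ** M)"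
  by (simp add: matrix_matrix_mult_def vec_eq_iff sum_distrib_left mult_ac)

lemma matrix_scaleR_right: "M ** (c *\<^sub>R X) = c *\<^sub>R (M ** (X :: real^'n^'m))"
  by (simp add: matrix_matrix_mult_def vec_eq_iff sum_distrib_left mult_ac)

lemma matrix_mult_sum_right: "M ** (\<Sum>i\<in>I. f i) = (\<Sum>i\<in>I. M ** (f i :: real^'n^'m))"
  by (induction I rule: infinite_finite_induct) (auto simp: matrix_add_ldistrib)

lemma matrix_mult_sum_left: "(\<Sum>i\<in>I. f i) ** M = (\<Sum>i\<in>I. (f i :: real^'n^'m) ** M)"
  by (induction I rule: infinite_finite_induct) (auto simp: matrix_add_rdistrib)

lemma sym_mats_subspace: "subspace sym_mats"
  by (auto simp: subspace_def sym_mats_def transpose_add transpose_scalar)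
    (simp add: transpose_def vec_eq_iff)

lemmas sym_mats_add = subspace_add[OF sym_mats_subspace]
  and sym_mats_diff = subspace_diff[OF sym_mats_subspace]
  and sym_mats_neg = subspace_neg[OF sym_mats_subspace]
  and sym_mats_scale = subspace_scale[OF sym_mats_subspace]
  and sym_mats_0 = subspace_0[OF sym_mats_subspace]

lemma outer_sym: "outer v v \<in> sym_mats"
  by (simp add: sym_mats_def transpose_outer)

lemma sym_mats_inner:
  assumes "M \<in> sym_mats"
  shows "(M *v x) \<bullet> y = x \<bullet> (M *v y)"
  using assms dot_lmul_matrix[of x M y] transpose_matrix_vector[of M x]
  by (simp add: sym_mats_def del: transpose_matrix_vector)

text \<open>A maximizer of the Rayleigh quotient over the unit sphere of the invariant subspace is an
  eigenvector.\<close>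

lemma symmetric_eigenvector_exists:
  assumes M: "M \<in> sym_mats" and T: "subspace T" "\<And>v. v \<in> T \<Longrightarrow> M *v v \<in> T" "T \<noteq> {0}"
  obtains v l where "v \<in> T" "norm v = 1" "M *v v = l *\<^sub>R (v :: real^'n)"
proof -
  obtain u where u: "u \<in> T" "u \<noteq> 0" using T subspace_0 by blast
  then have "u /\<^sub>R norm u \<in> T \<inter> sphere 0 1" using subspace_scale[OF T(1)] by simp
  then have ne: "T \<inter> sphere 0 1 \<noteq> {}" by blast
  have "compact (T \<inter> sphere 0 1)" by (rule closed_Int_compact[OF closed_subspace[OF T(1)] compact_sphere])
  moreover have "continuous_on (T \<inter> sphere 0 1) (\<lambda>v. v \<bullet> (M *v v))"
    by (intro continuous_intros matrix_vector_mult_linear_continuous_on)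
  ultimately have "\<exists>v\<in>T \<inter> sphere 0 1. \<forall>w\<in>T \<inter> sphere 0 1. w \<bullet> (M *v w) \<le> v \<bullet> (M *v v)"
    by (rule continuous_attains_sup[OF _ ne])
  then obtain v where v: "v \<in> T" "norm v = 1"
    and max: "\<And>w. w \<in> T \<Longrightarrow> norm w = 1 \<Longrightarrow> w \<bullet> (M *v w) \<le> v \<bullet> (M *v v)"
    by auto
  define l where "l = v \<bullet> (M *v v)"
  have vv: "v \<bullet> v = 1" using v by (simp add: dot_square_norm)
  have hom: "w \<bullet> (M *v w) \<le> l * (w \<bullet> w)" if w: "w \<in> T" for w
  proof (cases "w = 0")
    case False
    have "w /\<^sub>R norm w \<in> T" using w subspace_scale[OF T(1)] by blast
    then have "(w /\<^sub>R norm w) \<bullet> (M *v (w /\<^sub>R norm w)) \<le> l"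
      unfolding l_def using False by (intro max) auto
    moreover have "(w /\<^sub>R norm w) \<bullet> (M *v (w /\<^sub>R norm w)) = (w \<bullet> (M *v w)) / (norm w)\<^sup>2"
      by (simp add: matrix_vector_mult_scaleR power2_eq_square divide_inverse)
    ultimately show ?thesis using False by (simp add: pos_divide_le_eq dot_square_norm)
  qed simp
  \<comment> \<open>The first-order condition at the maximizer \<open>v\<close>, tested in the direction of the
      residual \<open>w\<close> itself.\<close>
  define w where "w = M *v v - l *\<^sub>R v"
  have wT: "w \<in> T" unfolding w_def using v(1) by (intro subspace_diff subspace_scale T)
  have wv: "w \<bullet> v = 0" by (simp add: w_def inner_diff_left vv l_def inner_commute[of "M *v v" v])
  have "M *v v = w + l *\<^sub>R v" by (simp add: w_def)
  then have wMv: "w \<bullet> (M *v v) = w \<bullet> w" by (simp add: inner_add_right wv)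
  define b where "b = w \<bullet> (M *v w) - l * (w \<bullet> w)"
  have quad: "2 * t * (w \<bullet> w) + t\<^sup>2 * b \<le> 0" for t
  proof -
    have inT: "v + t *\<^sub>R w \<in> T" using v(1) wT by (intro subspace_add subspace_scale T(1))
    have "v \<bullet> (M *v w) = w \<bullet> w"
      using sym_mats_inner[OF M, of v w] wMv inner_commute[of w "M *v v"] by linarith
    then have e1: "(v + t *\<^sub>R w) \<bullet> (M *v (v + t *\<^sub>R w)) = l + 2 * t * (w \<bullet> w) + t\<^sup>2 * (w \<bullet> (M *v w))"
      by (simp add: matrix_vector_right_distrib matrix_vector_mult_scaleR inner_add_left
          inner_add_right wMv l_def[symmetric] power2_eq_square distrib_left)
    have e2: "(v + t *\<^sub>R w) \<bullet> (v + t *\<^sub>R w) = 1 + t\<^sup>2 * (w \<bullet> w)"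
      using wv inner_commute[of v w] by (simp add: inner_add_left inner_add_right vv power2_eq_square)
    have "l + 2 * t * (w \<bullet> w) + t\<^sup>2 * (w \<bullet> (M *v w)) \<le> l * (1 + t\<^sup>2 * (w \<bullet> w))"
      using hom[OF inT] unfolding e1 e2 .
    moreover have "t\<^sup>2 * b = t\<^sup>2 * (w \<bullet> (M *v w)) - l * (t\<^sup>2 * (w \<bullet> w))"
      by (simp only: b_def right_diff_distrib mult.left_commute)
    moreover have "l * (1 + t\<^sup>2 * (w \<bullet> w)) = l + l * (t\<^sup>2 * (w \<bullet> w))" by (simp only: distrib_left mult_1_right)
    ultimately show ?thesis by linarith
  qed
  have "w \<bullet> w \<le> 0"
  proof (rule ccontr)
    assume "\<not> w \<bullet> w \<le> 0"
    then have pos: "w \<bullet> w > 0" by linarith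
    define t where "t = (w \<bullet> w) / (\<bar>b\<bar> + 1)"
    have t: "t > 0" using pos unfolding t_def by (intro divide_pos_pos) auto
    have "t * (\<bar>b\<bar> + 1) = w \<bullet> w" by (simp add: t_def)
    then have tb: "t * \<bar>b\<bar> \<le> w \<bullet> w" using t by (simp add: distrib_left)
    have "t * (2 * (w \<bullet> w) + t * b) \<le> 0"
      using quad[of t] by (simp add: distrib_left power2_eq_square mult.left_commute mult.assoc)
    then have "2 * (w \<bullet> w) + t * b \<le> 0" using t by (simp add: mult_le_0_iff)
    moreover have "- (t * b) \<le> t * \<bar>b\<bar>" using t mult_left_mono[of "- b" "\<bar>b\<bar>" t] by simp
    ultimately show False using tb pos by linarith
  qed
  then have "w \<bullet> w = 0" using inner_ge_zero[of w] by linarith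
  then have "w = 0" by simp
  then have "M *v v = l *\<^sub>R v" by (simp add: w_def)
  then show ?thesis using that v by blast
qed

text \<open>The orthogonal complement, within an invariant subspace, of an eigenvector is again
  invariant, so eigenvectors can be split off one at a time.\<close>

lemma symmetric_orthonormal_eigenbasis:
  fixes M :: "real^'n^'n"
  assumes M: "M \<in> sym_mats" and T: "subspace T" "\<And>v. v \<in> T \<Longrightarrow> M *v v \<in> T"
  shows "\<exists>B. pairwise orthogonal B \<and> span B = T \<and> (\<forall>v\<in>B. norm v = 1 \<and> (\<exists>l. M *v v = l *\<^sub>R v))"
  using T
proof (induction "dim T" arbitrary: T rule: less_induct)
  case less
  show ?case
  proof (cases "T = {0}")
    case True
    then show ?thesis by (intro exI[of _ "{}"]) (auto simp: pairwise_def)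
  next
    case False
    obtain v l where v: "v \<in> T" "norm v = 1" "M *v v = l *\<^sub>R v"
      using symmetric_eigenvector_exists[OF M less.prems False] by metis
    have vv: "v \<bullet> v = 1" using v by (simp add: dot_square_norm)
    define T' where "T' = {w \<in> T. w \<bullet> v = 0}"
    have sT': "subspace T'"
      using less.prems(1) by (auto simp: T'_def subspace_def inner_add_left)
    have "v \<notin> T'" using vv by (simp add: T'_def)
    moreover have "T' \<subseteq> T" by (auto simp: T'_def)
    ultimately have "T' \<subset> T" using v(1) by blast
    then have "span T' \<subset> span T" using sT' less.prems(1) by (simp add: span_eq_iff[THEN iffD2])
    then have "dim T' < dim T" by (rule dim_psubset)
    moreover have "M *v w \<in> T'" if "w \<in> T'" for w
      using that less.prems(2) v sym_mats_inner[OF M, of w v] by (auto simp: T'_def)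
    ultimately obtain B where B: "pairwise orthogonal B" "span B = T'"
      "\<forall>v\<in>B. norm v = 1 \<and> (\<exists>l. M *v v = l *\<^sub>R v)"
      using less.hyps[OF _ sT'] by blast
    have "B \<subseteq> T'" using B(2) span_superset by blast
    then have orth: "\<forall>w\<in>B. orthogonal w v" by (auto simp: T'_def orthogonal_def)
    have "span (insert v B) = T"
    proof
      show "span (insert v B) \<subseteq> T"
        using \<open>B \<subseteq> T'\<close> v less.prems(1) by (intro span_minimal) (auto simp: T'_def)
      show "T \<subseteq> span (insert v B)"
      proof
        fix x assume x: "x \<in> T"
        have "x - (x \<bullet> v) *\<^sub>R v \<in> T'"
          using x v less.prems(1) vv by (auto simp: T'_def inner_diff_left subspace_diff subspace_scale)
        then show "x \<in> span (insert v B)" unfolding span_breakdown_eq using B(2) by blast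
      qed
    qed
    moreover have "pairwise orthogonal (insert v B)"
      using B(1) orth by (simp add: pairwise_insert orthogonal_commute)
    moreover have "\<forall>u\<in>insert v B. norm u = 1 \<and> (\<exists>l. M *v u = l *\<^sub>R u)" using B(3) v by blast
    ultimately show ?thesis by blast
  qed
qed

lemma spectral_decomposition:
  fixes M :: "real^'n^'n"
  assumes M: "M \<in> sym_mats"
  obtains Q d where "eigen_decomp M Q d"
proof -
  obtain B where B: "pairwise orthogonal B" "span B = UNIV"
      "\<forall>v\<in>B. norm v = 1 \<and> (\<exists>l. M *v v = l *\<^sub>R v)"
    using symmetric_orthonormal_eigenbasis[OF M subspace_UNIV UNIV_I] by blast
  have "0 \<notin> B" using B(3) norm_zero zero_neq_one by metis
  then have "independent B" using B(1) by (rule pairwise_orthogonal_independent[rotated])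
  then have fin: "finite B" and "card B = CARD('n)"
    using B(2) dim_eq_card_independent[of B] independent_imp_finite dim_span[of B]
    by (auto simp: dim_UNIV)
  then obtain f :: "'n \<Rightarrow> real^'n" where f: "bij_betw f UNIV B"
    using finite_same_card_bij[of "UNIV :: 'n set" B] by auto
  have fB: "f i \<in> B" for i using f by (auto simp: bij_betw_def)
  define Q :: "real^'n^'n" where "Q = (\<chi> a i. f i $ a)"
  have col: "column i Q = f i" for i by (simp add: column_def Q_def vec_eq_iff)
  have orth: "orthogonal_matrix Q"
    unfolding orthogonal_matrix_orthonormal_columns col
  proof (intro conjI allI impI)
    fix i j :: 'n assume "i \<noteq> j"
    then have "f i \<noteq> f j" using f by (auto simp: bij_betw_def inj_on_def)
    then show "orthogonal (f i) (f j)" using B(1) fB by (auto simp: pairwise_def)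
  qed (use B fB in auto)
  have "\<forall>i. \<exists>l. M *v f i = l *\<^sub>R f i" using B(3) fB by blast
  from choice[OF this] obtain d where d: "\<And>i. M *v f i = d i *\<^sub>R f i" by blast
  have "M ** Q = Q ** diag_mat d"
  proof -
    have "(M ** Q) $ a $ i = (Q ** diag_mat d) $ a $ i" for a i
    proof -
      have "(M ** Q) $ a $ i = (M *v f i) $ a"
        by (simp add: matrix_matrix_mult_def matrix_vector_mult_def Q_def)
      also have "\<dots> = (Q ** diag_mat d) $ a $ i"
        by (simp add: d matrix_matrix_mult_def diag_mat_def Q_def if_distrib sum.delta cong: if_cong)
      finally show ?thesis .
    qed
    then show ?thesis by (simp add: vec_eq_iff)
  qed
  then have "Q ** diag_mat d ** transpose Q = M ** (Q ** transpose Q)" by (simp add: matrix_mul_assoc)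
  then have "M = Q ** diag_mat d ** transpose Q" using orth by (simp add: orthogonal_matrix_def)
  then show ?thesis using that orth by (simp add: eigen_decomp_def)
qed

lemma neg_mult_vec: "(- M) *v v = - (M *v (v :: real^'n))"
  by (simp add: vec_eq_iff matrix_vector_mult_def sum_negf)

lemma sandwich_diag:
  "Q ** diag_mat d ** transpose Q = (\<Sum>i\<in>UNIV. d i *\<^sub>R outer (column i Q) (column i Q))"
proof -
  have "Q ** diag_mat d = (\<chi> a i. Q $ a $ i * d i)"
    by (simp add: vec_eq_iff matrix_matrix_mult_def diag_mat_def if_distrib[where f = "(*) _"]
        sum.delta cong: if_cong)
  then show ?thesis
    by (simp add: vec_eq_iff matrix_matrix_mult_def outer_def column_def transpose_def)
      (simp add: mult.left_commute mult.commute)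
qed

lemma eigen_decomp_sum:
  "eigen_decomp M Q d \<Longrightarrow> M = (\<Sum>i\<in>UNIV. d i *\<^sub>R outer (column i Q) (column i Q))"
  unfolding eigen_decomp_def sandwich_diag by blast

lemma eigen_decomp_orthonormal:
  assumes "eigen_decomp M Q d"
  shows "column i Q \<bullet> column j Q = (if i = j then 1 else 0)"
  using assms unfolding eigen_decomp_def orthogonal_matrix_orthonormal_columns
  by (auto simp: orthogonal_def dot_square_norm)

lemma inner_eq_sum_eigen:
  "eigen_decomp M Q d \<Longrightarrow> M \<bullet> N = (\<Sum>i\<in>UNIV. d i * (column i Q \<bullet> (N *v column i Q)))"
  by (subst eigen_decomp_sum) (auto simp: inner_sum_left inner_outer)

lemma trace_eq_sum_eigen:
  "eigen_decomp M Q d \<Longrightarrow> trace M = (\<Sum>i\<in>UNIV. d i)"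
  using inner_eq_sum_eigen[of M Q d "mat 1"] eigen_decomp_orthonormal[of M Q d]
  by (simp add: trace_eq_inner)

lemma mult_vec_eq_sum_eigen:
  assumes "eigen_decomp M Q d"
  shows "M *v x = (\<Sum>i\<in>UNIV. (d i * (column i Q \<bullet> x)) *\<^sub>R column i Q)"
proof -
  have "(\<Sum>i\<in>UNIV. N i) *v x = (\<Sum>i\<in>UNIV. N i *v x)" for N :: "'a \<Rightarrow> real^'a^'a"
    by (rule linear_sum[of "\<lambda>M. M *v x"])
      (auto intro!: linearI simp: matrix_vector_mult_add_rdistrib scaleR_matrix_vector_assoc)
  then show ?thesis
    using eigen_decomp_sum[OF assms]
    by (simp add: outer_mult_vec scaleR_matrix_vector_assoc[symmetric])
qed

lemma eigen_decomp_eigenvector: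
  assumes "eigen_decomp M Q d"
  shows "M *v column i Q = d i *\<^sub>R column i Q"
  by (simp add: mult_vec_eq_sum_eigen[OF assms] eigen_decomp_orthonormal[OF assms] if_distrib
      if_distribR sum.delta cong: if_cong)

lemma inner_eq_sum_coords:
  assumes "eigen_decomp M Q d"
  shows "x \<bullet> y = (\<Sum>i\<in>UNIV. (column i Q \<bullet> x) * (column i Q \<bullet> y))"
proof -
  have "Q ** transpose Q = mat 1" using assms by (simp add: eigen_decomp_def orthogonal_matrix_def)
  then have *: "eigen_decomp (mat 1) Q (\<lambda>i. 1)"
    using assms by (simp add: eigen_decomp_def diag_mat_def mat_def[symmetric])
  have "x = (\<Sum>i\<in>UNIV. (column i Q \<bullet> x) *\<^sub>R column i Q)"
    using mult_vec_eq_sum_eigen[OF *, of x] by simp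
  then have "x \<bullet> y = (\<Sum>i\<in>UNIV. (column i Q \<bullet> x) *\<^sub>R column i Q) \<bullet> y" by (rule arg_cong)
  then show ?thesis by (simp only: inner_sum_left inner_scaleR_left)
qed

lemma quad_eq_sum_eigen:
  assumes "eigen_decomp M Q d"
  shows "x \<bullet> (M *v x) = (\<Sum>i\<in>UNIV. d i * (column i Q \<bullet> x)\<^sup>2)"
  by (simp add: mult_vec_eq_sum_eigen[OF assms] inner_sum_right inner_commute[of x]
      power2_eq_square mult_ac)

lemma eigenvalues_eq_range:
  assumes "eigen_decomp M Q d"
  shows "eigenvalues M = range d"
proof
  show "range d \<subseteq> eigenvalues M"
  proof clarify
    fix i
    have "column i Q \<noteq> 0"
      using eigen_decomp_orthonormal[OF assms, of i i] by (metis inner_zero_left zero_neq_one)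
    then show "d i \<in> eigenvalues M"
      using eigen_decomp_eigenvector[OF assms] by (auto simp: eigenvalues_def)
  qed
  show "eigenvalues M \<subseteq> range d"
  proof
    fix l assume "l \<in> eigenvalues M"
    then obtain v where v: "v \<noteq> 0" "M *v v = l *\<^sub>R v" by (auto simp: eigenvalues_def)
    have "v \<bullet> v \<noteq> 0" using v by simp
    then have "(\<Sum>i\<in>UNIV. (column i Q \<bullet> v) * (column i Q \<bullet> v)) \<noteq> 0"
      using inner_eq_sum_coords[OF assms, of v v] by metis
    then obtain i where i: "column i Q \<bullet> v \<noteq> 0"
      by (metis (mono_tags, lifting) mult_eq_0_iff sum.neutral)
    have "column i Q \<bullet> (M *v v) = d i * (column i Q \<bullet> v)"
      by (simp add: mult_vec_eq_sum_eigen[OF assms] inner_sum_right eigen_decomp_orthonormal[OF assms]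
          if_distrib sum.delta cong: if_cong)
    then have "l = d i" using v i by simp
    then show "l \<in> range d" by blast
  qed
qed

lemma lambda_max_eq_Max: "eigen_decomp M Q d \<Longrightarrow> lambda_max M = Max (range d)"
  by (simp add: lambda_max_def eigenvalues_eq_range)

lemma eigen_le_lambda_max: "eigen_decomp M Q d \<Longrightarrow> d i \<le> lambda_max M"
  by (simp add: lambda_max_eq_Max)

lemma quad_le_lambda_max:
  assumes "M \<in> sym_mats"
  shows "x \<bullet> (M *v x) \<le> lambda_max M * (x \<bullet> x)"
proof -
  obtain Q d where e: "eigen_decomp M Q d" using spectral_decomposition[OF assms] .
  have "x \<bullet> (M *v x) \<le> (\<Sum>i\<in>UNIV. lambda_max M * (column i Q \<bullet> x)\<^sup>2)"
    unfolding quad_eq_sum_eigen[OF e]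
    by (intro sum_mono mult_right_mono eigen_le_lambda_max[OF e]) auto
  then show ?thesis by (simp add: inner_eq_sum_coords[OF e, of x x] sum_distrib_left power2_eq_square)
qed

lemma lambda_max_attained:
  fixes M :: "real^'n^'n"
  assumes "M \<in> sym_mats"
  obtains v where "norm v = 1" "M *v v = lambda_max M *\<^sub>R v"
proof -
  obtain Q d where e: "eigen_decomp M Q d" using spectral_decomposition[OF assms] .
  have "Max (range d) \<in> range d" by (intro Max_in) auto
  then obtain i where "lambda_max M = d i" unfolding lambda_max_eq_Max[OF e] by blast
  then show ?thesis
    using that[of "column i Q"] eigen_decomp_eigenvector[OF e] eigen_decomp_orthonormal[OF e, of i i]
    by (simp add: norm_eq_1)
qed

lemma lambda_max_le_iff:
  assumes "M \<in> sym_mats"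
  shows "lambda_max M \<le> c \<longleftrightarrow> (\<forall>x. x \<bullet> (M *v x) \<le> c * (x \<bullet> x))"
proof
  assume "lambda_max M \<le> c"
  then show "\<forall>x. x \<bullet> (M *v x) \<le> c * (x \<bullet> x)"
    using quad_le_lambda_max[OF assms] by (meson inner_ge_zero mult_right_mono order_trans)
next
  assume R: "\<forall>x. x \<bullet> (M *v x) \<le> c * (x \<bullet> x)"
  obtain v where "norm v = 1" "M *v v = lambda_max M *\<^sub>R v" using lambda_max_attained[OF assms] .
  then show "lambda_max M \<le> c" using R[rule_format, of v] by (simp add: norm_eq_1)
qed

lemma lambda_min_eq: 
  assumes "M \<in> sym_mats"
  shows "lambda_min M = - lambda_max (- M)"
proof -
  obtain Q d where e: "eigen_decomp M Q d" using spectral_decomposition[OF assms] .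
  have "l \<in> eigenvalues (- M) \<longleftrightarrow> - l \<in> eigenvalues M" for l
  proof -
    have "(- M) *v v = l *\<^sub>R v \<longleftrightarrow> M *v v = (- l) *\<^sub>R v" for v
      using minus_equation_iff[of "M *v v" "l *\<^sub>R v"] by (auto simp: neg_mult_vec)
    then show ?thesis by (simp add: eigenvalues_def)
  qed
  moreover have "l \<in> uminus ` eigenvalues M \<longleftrightarrow> - l \<in> eigenvalues M" for l
    by (auto intro: image_eqI[of _ _ "- l"])
  ultimately have "eigenvalues (- M) = uminus ` eigenvalues M" by blast
  moreover have "finite (eigenvalues M)" "eigenvalues M \<noteq> {}"
    by (simp_all add: eigenvalues_eq_range[OF e])
  then have "- Min (eigenvalues M) = Max (uminus ` eigenvalues M)" by (rule minus_Min_eq_Max)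
  ultimately have "lambda_max (- M) = - lambda_min M"
    unfolding lambda_min_def lambda_max_def by metis
  then show ?thesis by simp
qed

lemma psd_sym: "psd X \<Longrightarrow> X \<in> sym_mats"
  by (simp add: psd_def)

lemma psd_quad: "psd X \<Longrightarrow> 0 \<le> x \<bullet> (X *v x)"
  by (simp add: psd_def)

lemma psd_0: "psd 0"
  by (simp add: psd_def sym_mats_0)

lemma psd_add: "psd X \<Longrightarrow> psd Y \<Longrightarrow> psd (X + Y)"
  by (auto simp: psd_def sym_mats_add matrix_vector_mult_add_rdistrib inner_add_right)

lemma psd_scale: "psd X \<Longrightarrow> 0 \<le> c \<Longrightarrow> psd (c *\<^sub>R X)"
  by (auto simp: psd_def sym_mats_scale scaleR_matrix_vector_assoc[symmetric])

lemma psd_outer: "psd (outer v v)"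
  by (auto simp: psd_def outer_sym outer_mult_vec inner_commute)

lemma psd_sum: "(\<And>i. i \<in> I \<Longrightarrow> psd (f i)) \<Longrightarrow> psd (\<Sum>i\<in>I. f i)"
  by (induction I rule: infinite_finite_induct) (auto simp: psd_0 psd_add)

lemma psd_sandwich:
  assumes "psd S"
  shows "psd (V ** S ** transpose V)"
proof -
  have "x \<bullet> ((V ** S ** transpose V) *v x) = (x v* V) \<bullet> (S *v (x v* V))" for x
    by (metis dot_lmul_matrix matrix_vector_mul_assoc transpose_matrix_vector)
  moreover have "V ** S ** transpose V \<in> sym_mats"
    using assms by (simp add: psd_def sym_mats_def matrix_transpose_mul matrix_mul_assoc)
  ultimately show ?thesis using assms by (simp add: psd_def)
qed

lemma psd_eigen_nonneg:
  assumes "psd X" "eigen_decomp X Q d"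
  shows "0 \<le> d i"
  using psd_quad[OF assms(1), of "column i Q"]
  by (simp add: eigen_decomp_eigenvector[OF assms(2)] eigen_decomp_orthonormal[OF assms(2)])

lemma psd_iff_lambda_max:
  assumes "X \<in> sym_mats"
  shows "psd X \<longleftrightarrow> lambda_max (- X) \<le> 0"
  using assms by (simp add: psd_def lambda_max_le_iff sym_mats_neg neg_mult_vec)

lemma psd_inner_nonneg:
  assumes "psd X" "psd Z"
  shows "0 \<le> X \<bullet> Z"
proof -
  obtain Q d where e: "eigen_decomp X Q d" using spectral_decomposition[OF psd_sym[OF assms(1)]] .
  show ?thesis unfolding inner_eq_sum_eigen[OF e]
    by (intro sum_nonneg mult_nonneg_nonneg psd_eigen_nonneg[OF assms(1) e] psd_quad[OF assms(2)])
qed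

lemma psd_trace_nonneg: 
  assumes "psd X" shows "0 \<le> trace X"
proof -
  obtain Q d where e: "eigen_decomp X Q d" using spectral_decomposition[OF psd_sym[OF assms(1)]] .
  show ?thesis unfolding trace_eq_sum_eigen[OF e]
    by (intro sum_nonneg psd_eigen_nonneg[OF assms(1) e])
qed

lemma psd_norm_le_trace:
  assumes "psd X"
  shows "norm X \<le> trace X"
proof -
  obtain Q d where e: "eigen_decomp X Q d" using spectral_decomposition[OF psd_sym[OF assms(1)]] .
  have "norm (\<Sum>i\<in>UNIV. d i *\<^sub>R outer (column i Q) (column i Q)) \<le> (\<Sum>i\<in>UNIV. d i)"
    using psd_eigen_nonneg[OF assms e] eigen_decomp_orthonormal[OF e]
    by (intro order.trans[OF norm_sum] sum_mono) (simp add: norm_outer norm_eq_sqrt_inner[of "column _ Q"])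
  then show ?thesis by (simp add: eigen_decomp_sum[OF e, symmetric] trace_eq_sum_eigen[OF e])
qed

lemma psd_inner_le_trace_lambda_max:
  assumes X: "psd X" and M: "M \<in> sym_mats"
  shows "X \<bullet> M \<le> trace X * lambda_max M"
proof -
  obtain Q d where e: "eigen_decomp X Q d" using spectral_decomposition[OF psd_sym[OF assms(1)]] .
  have "X \<bullet> M \<le> (\<Sum>i\<in>UNIV. d i * lambda_max M)"
    unfolding inner_eq_sum_eigen[OF e]
    using quad_le_lambda_max[OF M] eigen_decomp_orthonormal[OF e] 
    by (intro sum_mono mult_left_mono psd_eigen_nonneg[OF X e]) (metis mult.right_neutral)
  then show ?thesis by (simp add: trace_eq_sum_eigen[OF e] sum_distrib_right)
qed

text \<open>In an eigenbasis this says that \<open>d\<^sub>i\<^sup>2 \<le> d\<^sub>i \<Sum>\<^sub>j d\<^sub>j\<close> for nonnegative eigenvalues. It makes a small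
  quadratic form imply a small image vector, at the price of a square root.\<close>

lemma psd_mult_vec_bound:
  assumes "psd Z"
  shows "(norm (Z *v u))\<^sup>2 \<le> trace Z * (u \<bullet> (Z *v u))"
proof -
  obtain Q d where e: "eigen_decomp Z Q d" using spectral_decomposition[OF psd_sym[OF assms(1)]] .
  note nn = psd_eigen_nonneg[OF assms e]
  have le: "d i \<le> trace Z" for i
    unfolding trace_eq_sum_eigen[OF e] using nn by (intro member_le_sum) auto
  have "column i Q \<bullet> (Z *v u) = d i * (column i Q \<bullet> u)" for i
    using sym_mats_inner[OF psd_sym[OF assms], of "column i Q" u]
    by (simp add: eigen_decomp_eigenvector[OF e])
  then have "(norm (Z *v u))\<^sup>2 = (\<Sum>i\<in>UNIV. d i * (d i * (column i Q \<bullet> u)\<^sup>2))"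
    unfolding power2_norm_eq_inner inner_eq_sum_coords[OF e, of "Z *v u" "Z *v u"]
    by (simp add: power2_eq_square mult_ac)
  also have "\<dots> \<le> (\<Sum>i\<in>UNIV. trace Z * (d i * (column i Q \<bullet> u)\<^sup>2))"
    using nn le by (intro sum_mono mult_right_mono) auto
  also have "\<dots> = trace Z * (u \<bullet> (Z *v u))"
    by (simp add: quad_eq_sum_eigen[OF e] sum_distrib_left)
  finally show ?thesis .
qed

text \<open>Expand \<open>X = \<Sum>\<^sub>i d\<^sub>i q\<^sub>i q\<^sub>i\<^sup>T\<close>, bound each \<open>\<parallel>Z q\<^sub>i\<parallel>\<close> by the previous lemma, and combine the terms by
  Cauchy-Schwarz. In particular \<open>X \<bullet> Z = 0\<close> forces \<open>Z X = 0\<close> for positive semidefinite \<open>X\<close> and \<open>Z\<close>.\<close>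

lemma psd_norm_mult_le:
  assumes X: "psd X" and Z: "psd Z"
  shows "(norm (Z ** X))\<^sup>2 \<le> trace X * trace Z * (X \<bullet> Z)"
proof -
  obtain Q d where e: "eigen_decomp X Q d" using spectral_decomposition[OF psd_sym[OF X]] .
  note nn = psd_eigen_nonneg[OF X e]
  define n where "n i = norm (Z *v column i Q)" for i
  have ZX: "Z ** X = (\<Sum>i\<in>UNIV. d i *\<^sub>R outer (Z *v column i Q) (column i Q))"
    by (subst eigen_decomp_sum[OF e])
      (simp add: matrix_mult_sum_right mult_outer matrix_scaleR_right)
  have "norm (Z ** X) \<le> (\<Sum>i\<in>UNIV. d i * n i)"
    unfolding ZX using nn eigen_decomp_orthonormal[OF e]
    by (intro order.trans[OF norm_sum] sum_mono) (simp add: norm_outer n_def norm_eq_sqrt_inner[of "column _ Q"])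
  then have "(norm (Z ** X))\<^sup>2 \<le> (\<Sum>i\<in>UNIV. sqrt (d i) * (sqrt (d i) * n i))\<^sup>2"
    using nn by (intro power_mono) (auto simp: mult.assoc[symmetric])
  also have "\<dots> \<le> (\<Sum>i\<in>UNIV. (sqrt (d i))\<^sup>2) * (\<Sum>i\<in>UNIV. (sqrt (d i) * n i)\<^sup>2)"
    by (rule Cauchy_Schwarz_ineq_sum)
  also have "\<dots> = trace X * (\<Sum>i\<in>UNIV. d i * (n i)\<^sup>2)"
    using nn by (simp add: trace_eq_sum_eigen[OF e] power_mult_distrib)
  also have "\<dots> \<le> trace X * (\<Sum>i\<in>UNIV. d i * (trace Z * (column i Q \<bullet> (Z *v column i Q))))"
    unfolding n_def using nn psd_trace_nonneg[OF X] psd_mult_vec_bound[OF Z]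
    by (intro mult_left_mono sum_mono) auto
  also have "\<dots> = trace X * trace Z * (X \<bullet> Z)"
    by (simp add: inner_eq_sum_eigen[OF e] sum_distrib_left mult_ac)
  finally show ?thesis .
qed

lemma quad_le_norm: "\<bar>v \<bullet> (M *v v)\<bar> \<le> norm M * (v \<bullet> (v :: real^'n))"
proof -
  have "\<bar>outer v v \<bullet> M\<bar> \<le> norm (outer v v) * norm M" by (rule Cauchy_Schwarz_ineq2)
  then show ?thesis
    by (simp add: inner_outer norm_outer dot_square_norm power2_eq_square mult.commute)
qed

lemma inner_eq_trace_mult:
  assumes "Z \<in> sym_mats"
  shows "X \<bullet> Z = trace (Z ** (X :: real^'n^'n))"
proof -
  have "Z $ i $ j = Z $ j $ i" for i j
    using assms by (simp add: sym_mats_def transpose_def vec_eq_iff)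
  then have "X \<bullet> Z = (\<Sum>i\<in>UNIV. \<Sum>j\<in>UNIV. Z $ j $ i * X $ i $ j)"
    by (simp add: inner_vec_def mult.commute)
  also have "\<dots> = trace (Z ** X)"
    unfolding trace_def matrix_matrix_mult_def by (subst sum.swap) simp
  finally show ?thesis .
qed

text \<open>The kernel of a symmetric matrix is the orthogonal complement of its range.\<close>

lemma symmetric_rank_nullity:
  fixes M :: "real^'n^'n"
  assumes "M \<in> sym_mats"
  shows "dim {v. M *v v = 0} + rank M = CARD('n)"
proof -
  have "M *v v = 0 \<longleftrightarrow> (\<forall>x\<in>range ((*v) M). orthogonal x v)" for v
    using sym_mats_inner[OF assms, of "M *v v" v]
    by (auto simp: orthogonal_def sym_mats_inner[OF assms]) (metis inner_eq_zero_iff)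
  then have "{v. M *v v = 0} = {v \<in> UNIV. \<forall>x\<in>range ((*v) M). orthogonal x v}" by simp
  moreover have "dim {v \<in> UNIV. \<forall>x\<in>range ((*v) M). orthogonal x v} + dim (range ((*v) M))
      = dim (UNIV :: (real^'n) set)"
    by (rule dim_subspace_orthogonal_to_vectors)
      (auto intro: linear_subspace_image[OF matrix_vector_mul_linear subspace_UNIV])
  ultimately show ?thesis by (simp add: rank_dim_range)
qed

lemma column_mult: "column i (V ** Q) = V *v column i (Q :: real^'r^'r)"
  by (simp add: column_def vec_eq_iff matrix_matrix_mult_def matrix_vector_mult_def)

lemma trace_orthonormal_sandwich:
  assumes "orthonormal_columns V"
  shows "trace (V ** S ** transpose V) = trace S"
proof -
  have "trace (V ** S ** transpose V) = trace (transpose V ** (V ** S))" by (rule trace_mul_sym)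
  then show ?thesis using assms by (simp add: matrix_mul_assoc orthonormal_columns_def)
qed

lemma orthonormal_columns_project:
  assumes V: "orthonormal_columns V" and v: "v \<in> span (columns V)"
  shows "V *v (transpose V *v v) = v"
proof -
  have "subspace {v. V *v (transpose V *v v) = v}"
    by (auto simp: subspace_def matrix_vector_right_distrib matrix_vector_mult_scaleR
        simp del: transpose_matrix_vector)
  moreover have "columns V \<subseteq> {v. V *v (transpose V *v v) = v}"
  proof clarify
    fix u assume "u \<in> columns V"
    then obtain j where "u = V *v axis j 1"
      by (auto simp: columns_def matrix_vector_mult_basis)
    then show "V *v (transpose V *v u) = u"
      using V by (simp add: orthonormal_columns_def matrix_vector_mul_assoc matrix_mul_assoc[symmetric]
          del: transpose_matrix_vector)
  qed
  ultimately show ?thesis using v span_minimal by blast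
qed

text \<open>A bundle basis whose span contains \<open>v\<close> represents the rank-one matrix \<open>v v\<^sup>T\<close> exactly.\<close>

lemma orthonormal_columns_outer:
  assumes "orthonormal_columns V" "v \<in> span (columns V)"
  shows "V ** outer (transpose V *v v) (transpose V *v v) ** transpose V = outer v v"
  by (simp add: mult_outer outer_mult_transpose orthonormal_columns_project[OF assms]
      del: transpose_matrix_vector)

section \<open>From one-step inequalities to an iteration bound\<close>

text \<open>It suffices that \<open>a\<^sup>p (1 + h) \<le> b\<^sup>p\<close>, and this follows from \<open>(1 - h) (1 + h) \<le> 1\<close> applied to a single factor.\<close>

lemma inverse_power_gap:
  fixes a b h :: real
  assumes "0 < a" "a \<le> b * (1 - h)" "0 < b" "0 \<le> h" "0 < p"
  shows "(1 + h) / b ^ p \<le> 1 / a ^ p"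
proof -
  obtain q where p: "p = Suc q" using assms(5) by (cases p) auto
  have ab: "a \<le> b" using assms mult_left_le[of "1 - h" b] by linarith
  have "a ^ p * (1 + h) = a ^ q * (a * (1 + h))" by (simp add: p)
  also have "\<dots> \<le> b ^ q * ((b * (1 - h)) * (1 + h))"
    using assms ab by (intro mult_mono power_mono mult_right_mono) auto
  also have "\<dots> = b ^ p * (1 - h\<^sup>2)" by (simp add: p power2_eq_square algebra_simps)
  also have "\<dots> \<le> b ^ p" using assms by (simp add: mult_left_le)
  finally show ?thesis using assms by (simp add: field_simps)
qed

text \<open>The recursion \<open>b \<le> a - c a\<^sup>2\<close> becomes additive for reciprocals, which yields the rate \<open>1/t\<close> of a run of null steps.\<close>

lemma null_step_inverse:
  fixes a b c :: real
  assumes "0 < a" "0 < b" "0 < c" "b \<le> a - c * a\<^sup>2"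
  shows "1 / (c * a) + 1 \<le> 1 / (c * b)"
proof -
  have "b * (1 + c * a) \<le> (a - c * a\<^sup>2) * (1 + c * a)"
    using assms by (intro mult_right_mono) auto
  also have "\<dots> = a - c\<^sup>2 * a ^ 3" by (simp add: algebra_simps power2_eq_square power3_eq_cube)
  also have "\<dots> \<le> a" using assms by simp
  finally have "b * (1 + c * a) \<le> a" .
  then have "b * (1 + c * a) / (c * a * b) \<le> a / (c * a * b)"
    using assms by (intro divide_right_mono) auto
  moreover have "b * (1 + c * a) / (c * a * b) = 1 / (c * a) + 1" "a / (c * a * b) = 1 / (c * b)"
    using assms by (simp_all add: divide_simps)
  ultimately show ?thesis by simp
qed

text \<open>The potential is \<open>1 / (c \<Delta>\<^sub>t) + B / \<delta>\<^sub>t\<^sup>P\<close> with \<open>P = 2k - 1\<close>. A null step leaves the second term alone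
  and raises the first by at least 1 (lemma \<open>null_step_inverse\<close>). A descent step may reset the first term, which
  costs at most \<open>1 / (c \<kappa> \<delta>\<^sub>t\<^sup>k)\<close>; but it multiplies \<open>\<delta>\<^sub>t\<close> by a factor of at most \<open>1 - \<beta> \<kappa> \<delta>\<^sub>t\<^sup>k\<^sup>-\<^sup>1\<close>, so the
  second term rises by at least a multiple of \<open>\<delta>\<^sub>t\<^sup>-\<^sup>k\<close> (lemma \<open>inverse_power_gap\<close>) and pays for that.
  The exponent \<open>P\<close> is the one for which the powers of \<open>\<delta>\<^sub>t\<close> in this balance agree. Once \<open>\<delta>\<^sub>t \<le> \<epsilon>\<close>,
  every descent step has \<open>\<beta> \<Delta>\<^sub>t \<le> \<epsilon>\<close> already, so only the crossing of the level \<open>\<epsilon>\<close> needs an extra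
  bonus \<open>E / \<epsilon>\<^sup>P\<close>.\<close>

lemma bundle_rate:
  fixes \<delta> \<Delta> :: "nat \<Rightarrow> real"
  assumes \<beta>: "0 < \<beta>" and c: "0 < c" and \<kappa>: "0 < \<kappa>" and k: "1 \<le> k"
    and nonneg: "\<And>t. 0 \<le> \<delta> t"
    and step: "\<And>t. \<beta> * \<Delta> t \<le> \<delta> t - \<delta> (Suc t) \<or>
                   \<delta> (Suc t) = \<delta> t \<and> \<Delta> (Suc t) \<le> \<Delta> t - c * (\<Delta> t)\<^sup>2"
    and growth: "\<And>t. \<kappa> * \<delta> t ^ k \<le> \<Delta> t"
  shows "\<exists>K. \<forall>\<epsilon>. 0 < \<epsilon> \<and> \<epsilon> \<le> 1 \<longrightarrow>
           (\<exists>t. real t \<le> K / \<epsilon> ^ (2 * k - 1) \<and> \<delta> t \<le> \<epsilon> \<and> \<beta> * \<Delta> t \<le> \<epsilon>)"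
proof -
  define P where "P = 2 * k - 1"
  have P: "0 < P" "k \<le> P" using k by (auto simp: P_def)
  define m where "m = min (1 / \<beta>) \<kappa>"
  have m: "0 < m" "m \<le> 1 / \<beta>" "m \<le> \<kappa>" using \<beta> \<kappa> by (auto simp: m_def)
  define D where "D = max (\<delta> 0) 1"
  define E where "E = 1 / (c * m) + 1"
  define B where "B = (1 / (c * \<kappa>) + D ^ k) / (\<beta> * \<kappa>)"
  have D: "1 \<le> D" "\<delta> 0 \<le> D" by (auto simp: D_def)
  have B: "0 < B" unfolding B_def using c \<kappa> \<beta> D by (intro divide_pos_pos add_pos_pos) auto
  have E: "0 < E" using c m by (simp add: E_def add_pos_pos)
  have DeltaGe: "0 \<le> \<Delta> t" for t
    using growth[of t] mult_nonneg_nonneg[OF less_imp_le[OF \<kappa>] zero_le_power[OF nonneg[of t], of k]]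
    by linarith
  have mono: "\<delta> (Suc t) \<le> \<delta> t" for t
    using step[of t] mult_nonneg_nonneg[OF less_imp_le[OF \<beta>] DeltaGe[of t]] by linarith
  have deltaD: "\<delta> t \<le> D" for t
    by (induction t) (use D mono in \<open>auto intro: order.trans\<close>)
  \<comment> \<open>The summand 2 pays for rounding the bound up to an integer.\<close>
  define K where "K = 1 / (c * m) + B + E + 2"
  show ?thesis
  proof (intro exI[of _ K] allI impI)
    fix \<epsilon> :: real assume eps: "0 < \<epsilon> \<and> \<epsilon> \<le> 1"
    have epsk: "0 < \<epsilon> ^ k" "\<epsilon> ^ P \<le> \<epsilon> ^ k" "\<epsilon> ^ P \<le> 1" "0 < \<epsilon> ^ P" "\<epsilon> ^ k \<le> \<epsilon>" "\<epsilon> ^ k \<le> 1"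
      using eps P k by (auto intro: power_decreasing power_le_one)
        (metis eps k less_imp_le power_decreasing power_one_right)
    define good where "good t \<longleftrightarrow> \<delta> t \<le> \<epsilon> \<and> \<beta> * \<Delta> t \<le> \<epsilon>" for t
    \<comment> \<open>The case distinction in \<open>\<psi>\<close> truncates the second term of the potential at level \<open>\<epsilon>\<close>.\<close>
    define \<psi> where "\<psi> t = (if \<epsilon> < \<delta> t then B / \<delta> t ^ P else B / \<epsilon> ^ P + E / \<epsilon> ^ P)" for t
    define \<Phi> where "\<Phi> t = 1 / (c * \<Delta> t) + \<psi> t" for t
    have Dlow: "m * \<epsilon> ^ k \<le> \<Delta> t" if "\<not> good t" for t
    proof (cases "\<delta> t \<le> \<epsilon>")
      case True
      have "m * \<epsilon> ^ k \<le> (1 / \<beta>) * \<epsilon>" using m epsk \<beta> by (intro mult_mono) auto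
      moreover have "\<epsilon> / \<beta> < \<Delta> t"
        using that True \<beta> by (auto simp: good_def pos_divide_less_eq mult.commute)
      ultimately show ?thesis by simp
    next
      case False
      have "m * \<epsilon> ^ k \<le> \<kappa> * \<delta> t ^ k" using m eps False \<kappa> by (intro mult_mono power_mono) auto
      then show ?thesis using growth[of t] by linarith
    qed
    have Dpos: "0 < \<Delta> t" if "\<not> good t" for t
      using Dlow[OF that] m epsk by (meson less_le_trans mult_pos_pos)
    have cD: "1 / (c * \<Delta> t) \<le> 1 / (c * m) / \<epsilon> ^ k" if "\<not> good t" for t
    proof -
      have "1 / (c * \<Delta> t) \<le> 1 / (c * (m * \<epsilon> ^ k))"
        using Dlow[OF that] c m epsk Dpos[OF that] by (intro divide_left_mono mult_left_mono mult_pos_pos) auto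
      then show ?thesis by (simp add: mult.assoc)
    qed
    have inc: "\<Phi> t + 1 \<le> \<Phi> (Suc t)" if ng: "\<not> good t" "\<not> good (Suc t)" for t
    proof (cases "\<beta> * \<Delta> t \<le> \<delta> t - \<delta> (Suc t)")
      case False
      then have s: "\<delta> (Suc t) = \<delta> t" "\<Delta> (Suc t) \<le> \<Delta> t - c * (\<Delta> t)\<^sup>2" using step[of t] by auto
      then show ?thesis
        using null_step_inverse[OF Dpos[OF ng(1)] Dpos[OF ng(2)] c s(2)] by (simp add: \<Phi>_def \<psi>_def)
    next
      case True
      \<comment> \<open>Below level \<open>\<epsilon>\<close> a descent step would make \<open>t\<close> good, as \<open>\<beta> \<Delta>\<^sub>t \<le> \<delta>\<^sub>t \<le> \<epsilon>\<close>.\<close>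
      have big: "\<epsilon> < \<delta> t"
      proof (rule ccontr)
        assume "\<not> \<epsilon> < \<delta> t"
        moreover from this have "\<beta> * \<Delta> t \<le> \<epsilon>" using True nonneg[of "Suc t"] by linarith
        ultimately show False using ng(1) by (simp add: good_def)
      qed
      have d0: "0 < \<delta> t" using big eps by linarith
      have "1 / (c * \<Delta> t) + 1 + \<psi> t \<le> \<psi> (Suc t)"
      proof (cases "\<epsilon> < \<delta> (Suc t)")
        case True': True
        define h where "h = \<beta> * \<kappa> * \<delta> t ^ (k - 1)"
        have kk: "\<delta> t ^ k = \<delta> t * \<delta> t ^ (k - 1)" using k by (metis Suc_diff_1 less_eq_Suc_le One_nat_def power_Suc)
        have h: "0 \<le> h" using \<beta> \<kappa> d0 by (simp add: h_def)
        have "\<beta> * (\<kappa> * \<delta> t ^ k) \<le> \<beta> * \<Delta> t" using growth[of t] \<beta> by simp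
        then have "\<delta> (Suc t) \<le> \<delta> t * (1 - h)" using True by (simp add: h_def kk algebra_simps)
        then have "(1 + h) / \<delta> t ^ P \<le> 1 / \<delta> (Suc t) ^ P"
          using True' eps d0 h P by (intro inverse_power_gap) auto
        then have gap: "B * ((1 + h) / \<delta> t ^ P) \<le> B * (1 / \<delta> (Suc t) ^ P)"
          using B by (intro mult_left_mono) auto
        have "P = (k - 1) + k" using k by (simp add: P_def)
        then have "h / \<delta> t ^ P = \<beta> * \<kappa> / \<delta> t ^ k"
          using d0 by (simp add: h_def power_add)
        then have "B * (h / \<delta> t ^ P) = (1 / (c * \<kappa>) + D ^ k) / \<delta> t ^ k"
          using \<beta> \<kappa> by (simp add: B_def)
        also have "\<dots> = 1 / (c * (\<kappa> * \<delta> t ^ k)) + D ^ k / \<delta> t ^ k" by (simp add: add_divide_distrib mult.assoc)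
        also have "\<dots> \<ge> 1 / (c * \<Delta> t) + 1"
        proof (rule add_mono)
          show "1 / (c * \<Delta> t) \<le> 1 / (c * (\<kappa> * \<delta> t ^ k))"
            using growth[of t] c \<kappa> d0 Dpos[OF ng(1)]
            by (intro divide_left_mono mult_left_mono mult_pos_pos) auto
          show "1 \<le> D ^ k / \<delta> t ^ k" using d0 deltaD[of t] by (simp add: power_mono)
        qed
        finally show ?thesis
          using gap True' big by (simp add: \<psi>_def distrib_left add_divide_distrib)
      next
        case False
        have "\<psi> t \<le> B / \<epsilon> ^ P"
          using big eps B d0 by (auto simp: \<psi>_def intro!: divide_left_mono power_mono)
        moreover have "1 / (c * \<Delta> t) + 1 \<le> E / \<epsilon> ^ P"
        proof -
          have "1 / (c * m) / \<epsilon> ^ k \<le> 1 / (c * m) / \<epsilon> ^ P"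
            using epsk c m by (intro divide_left_mono) auto
          moreover have "1 \<le> 1 / \<epsilon> ^ P" using epsk by simp
          ultimately show ?thesis using cD[OF ng(1)] by (simp add: E_def add_divide_distrib)
        qed
        ultimately show ?thesis using False by (simp add: \<psi>_def)
      qed
      moreover have "0 \<le> 1 / (c * \<Delta> (Suc t))" using c DeltaGe by simp
      ultimately show ?thesis unfolding \<Phi>_def by linarith
    qed
    have bound: "real N \<le> (K - 2) / \<epsilon> ^ P" if ng: "\<And>t. t \<le> N \<Longrightarrow> \<not> good t" for N
    proof -
      have "real n \<le> \<Phi> n" if "n \<le> N" for n
        using that
      proof (induction n)
        case 0
        have "0 \<le> \<psi> 0" using B E eps by (auto simp: \<psi>_def intro!: divide_nonneg_nonneg add_nonneg_nonneg)
        then show ?case using c DeltaGe[of 0] by (simp add: \<Phi>_def)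
      next
        case (Suc n)
        then show ?case using inc[of n] ng[of n] ng[of "Suc n"] by simp
      qed
      then have "real N \<le> \<Phi> N" by simp
      also have "\<dots> \<le> 1 / (c * m) / \<epsilon> ^ P + (B / \<epsilon> ^ P + E / \<epsilon> ^ P)"
      proof -
        have "1 / (c * m) / \<epsilon> ^ k \<le> 1 / (c * m) / \<epsilon> ^ P"
          using epsk c m by (intro divide_left_mono) auto
        moreover have "\<psi> N \<le> B / \<epsilon> ^ P + E / \<epsilon> ^ P"
        proof -
          have "B / \<delta> N ^ P \<le> B / \<epsilon> ^ P" if "\<epsilon> < \<delta> N"
            using that eps B by (intro divide_left_mono power_mono) auto
          moreover have "0 \<le> E / \<epsilon> ^ P" using E epsk by simp
          ultimately show ?thesis by (auto simp: \<psi>_def intro: add_increasing2)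
        qed
        ultimately show ?thesis using cD[of N] ng[of N] by (simp add: \<Phi>_def)
      qed
      also have "\<dots> = (K - 2) / \<epsilon> ^ P" by (simp add: K_def add_divide_distrib)
      finally show ?thesis .
    qed
    define N where "N = nat \<lfloor>(K - 2) / \<epsilon> ^ P\<rfloor> + 1"
    have K2: "0 \<le> (K - 2) / \<epsilon> ^ P" using B E c m epsk by (simp add: K_def)
    have "(K - 2) / \<epsilon> ^ P < real N" using K2 by (simp add: N_def) linarith
    then obtain t where t: "t \<le> N" "good t" using bound[of N] by force
    have "real N \<le> (K - 2) / \<epsilon> ^ P + 1" using K2 by (simp add: N_def)
    also have "\<dots> \<le> (K - 2) / \<epsilon> ^ P + 2 / \<epsilon> ^ P"
      using epsk by (simp add: field_simps)
    also have "\<dots> = K / \<epsilon> ^ P" by (simp add: diff_divide_distrib)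
    finally show "\<exists>t. real t \<le> K / \<epsilon> ^ (2 * k - 1) \<and> \<delta> t \<le> \<epsilon> \<and> \<beta> * \<Delta> t \<le> \<epsilon>"
      using t by (intro exI[of _ t]) (auto simp: good_def P_def)
  qed
qed

section \<open>Exact penalization and sublevel sets\<close>

locale sdp_pair =
  fixes C :: "real^'n^'n" and A :: "real^'n^'n \<Rightarrow> real^'m" and b :: "real^'m"
  assumes C_sym: "C \<in> sym_mats" and A_linear: "linear_on_sym A"
begin

abbreviation "At \<equiv> sym_adjoint A"

lemma At_sym: "At y \<in> sym_mats"
  using sym_adjoint_works[OF A_linear] by blast

lemma At_inner: "X \<in> sym_mats \<Longrightarrow> X \<bullet> At y = A X \<bullet> y"
  using sym_adjoint_works[OF A_linear, of y] by simp

lemma At_linear: "linear At"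
proof (rule linearI)
  fix x y :: "real^'m" and c :: real
  have E: "At (x + y) - (At x + At y) \<in> sym_mats" "At (c *\<^sub>R x) - c *\<^sub>R At x \<in> sym_mats"
    by (intro sym_mats_diff sym_mats_add sym_mats_scale At_sym)+
  have "(At (x + y) - (At x + At y)) \<bullet> (At (x + y) - (At x + At y)) = 0"
    unfolding inner_diff_right[of "At (x + y) - (At x + At y)"] inner_add_right
      At_inner[OF E(1)] by simp
  then show "At (x + y) = At x + At y" by simp
  have "(At (c *\<^sub>R x) - c *\<^sub>R At x) \<bullet> (At (c *\<^sub>R x) - c *\<^sub>R At x) = 0"
    unfolding inner_diff_right[of "At (c *\<^sub>R x) - c *\<^sub>R At x"] inner_scaleR_right
      At_inner[OF E(2)] by simp
  then show "At (c *\<^sub>R x) = c *\<^sub>R At x" by simp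
qed

lemma At_bounded: obtains B where "0 < B" "\<And>y. norm (At y) \<le> B * norm y"
  using linear_bounded_pos[OF At_linear] by blast

text \<open>The map \<open>A\<close> is constrained on symmetric matrices only, so its bound is obtained from that of
  the adjoint.\<close>

lemma A_bounded: obtains B where "0 < B" "\<And>X. X \<in> sym_mats \<Longrightarrow> norm (A X) \<le> B * norm X"
proof -
  obtain B where B: "0 < B" "\<And>y. norm (At y) \<le> B * norm y" using At_bounded by blast
  have "norm (A X) \<le> B * norm X" if X: "X \<in> sym_mats" for X
  proof (cases "A X = 0")
    case False
    have "norm (A X) * norm (A X) = X \<bullet> At (A X)"
      by (simp add: At_inner[OF X] dot_square_norm power2_eq_square)
    also have "\<dots> \<le> norm X * norm (At (A X))" by (rule norm_cauchy_schwarz)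
    also have "\<dots> \<le> norm X * (B * norm (A X))" by (intro mult_left_mono B) auto
    finally show ?thesis using False by (simp add: mult_ac)
  qed (use B in simp)
  then show ?thesis using that B(1) by blast
qed

abbreviation slack :: "real^'m \<Rightarrow> real^'n^'n" where
  "slack y \<equiv> C - At y"

lemma slack_sym: "slack y \<in> sym_mats" "At y - C \<in> sym_mats"
  by (simp_all add: sym_mats_diff C_sym At_sym)

definition violation :: "real^'m \<Rightarrow> real" where
  "violation y = max (lambda_max (At y - C)) 0"

lemma violation_nonneg: "0 \<le> violation y"
  by (simp add: violation_def)

lemma dual_feasible_iff: "y \<in> dual_feasible C A \<longleftrightarrow> violation y = 0"
  using psd_iff_lambda_max[OF slack_sym(1), of y]
  by (auto simp: dual_feasible_def loewner_le_def violation_def max_def)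

lemma lambda_min_slack: "- violation y \<le> lambda_min (slack y)"
  using lambda_min_eq[OF slack_sym(1), of y] by (simp add: violation_def)

lemma inner_le_violation:
  assumes "psd X" shows "X \<bullet> (At y - C) \<le> trace X * violation y"
proof -
  have "trace X * lambda_max (At y - C) \<le> trace X * violation y"
    using psd_trace_nonneg[OF assms] by (intro mult_left_mono) (auto simp: violation_def)
  then show ?thesis using psd_inner_le_trace_lambda_max[OF assms slack_sym(2), of y] by linarith
qed

lemma slack_shift_psd: "psd (slack y + violation y *\<^sub>R mat 1)"
proof -
  have 1: "(mat 1 :: real^'n^'n) \<in> sym_mats" by (simp add: sym_mats_def)
  have "0 \<le> v \<bullet> ((slack y + violation y *\<^sub>R mat 1) *v v)" for v
  proof -
    have "v \<bullet> ((At y - C) *v v) \<le> violation y * (v \<bullet> v)"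
      using lambda_max_le_iff[OF slack_sym(2), of y "violation y"] by (simp add: violation_def)
    then show ?thesis
      by (simp add: matrix_vector_mult_add_rdistrib matrix_vector_mult_diff_rdistrib inner_diff_right
          inner_add_right scaleR_matrix_vector_assoc[symmetric])
  qed
  then show ?thesis by (simp add: psd_def sym_mats_add slack_sym sym_mats_scale 1)
qed

end

locale penalized_sdp = sdp_pair C A b
  for C :: "real^'n^'n" and A :: "real^'n^'n \<Rightarrow> real^'m" and b :: "real^'m" +
  fixes \<alpha> :: real
  assumes strong_duality: "strong_duality C A b"
    and alpha_gt: "\<alpha> > (SUP X\<in>primal_solutions C A b. trace X)"
begin

abbreviation "Xs \<equiv> primal_solutions C A b"
abbreviation "Ys \<equiv> dual_solutions C A b"
abbreviation "F \<equiv> penalized_dual C A b \<alpha>"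

lemma F_eq: "F y = - (b \<bullet> y) + \<alpha> * violation y"
  by (simp add: penalized_dual_def violation_def)

lemma primal_solution:
  assumes "X \<in> Xs" shows "psd X" "A X = b" "trace X < \<alpha>"
proof -
  show "psd X" "A X = b" using assms by (auto simp: primal_solutions_def primal_feasible_def)
  have "compact Xs" using strong_duality by (simp add: strong_duality_def)
  moreover have "continuous_on Xs trace"
    unfolding trace_eq_inner[abs_def] by (intro continuous_intros)
  ultimately have "bdd_above (trace ` Xs)"
    by (intro bounded_imp_bdd_above compact_imp_bounded compact_continuous_image)
  then have "trace X \<le> (SUP X\<in>Xs. trace X)" using assms by (intro cSUP_upper)
  then show "trace X < \<alpha>" using alpha_gt by simp
qed

definition fopt :: real where "fopt = - (b \<bullet> (SOME y. y \<in> Ys))"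

lemma Xs_nonempty: obtains X where "X \<in> Xs"
  using strong_duality by (auto simp: strong_duality_def)

lemma Ys_nonempty: obtains y where "y \<in> Ys"
  using strong_duality by (auto simp: strong_duality_def)

lemma fopt_primal: "X \<in> Xs \<Longrightarrow> C \<bullet> X = - fopt"
  and fopt_dual: "y \<in> Ys \<Longrightarrow> b \<bullet> y = - fopt"
proof -
  obtain X0 where X0: "X0 \<in> Xs" using Xs_nonempty .
  obtain y0 where y0: "y0 \<in> Ys" using Ys_nonempty .
  have eq: "C \<bullet> X = b \<bullet> y" if "X \<in> Xs" "y \<in> Ys" for X y
    using strong_duality that by (force simp: strong_duality_def)
  have S: "(SOME y. y \<in> Ys) \<in> Ys" using y0 by (rule someI)
  show "X \<in> Xs \<Longrightarrow> C \<bullet> X = - fopt" using eq[OF _ S] by (simp add: fopt_def)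
  show "y \<in> Ys \<Longrightarrow> b \<bullet> y = - fopt" using eq[OF X0, of y] eq[OF X0 S] by (simp add: fopt_def)
qed

lemma alpha_pos: "0 < \<alpha>"
proof -
  obtain X where "X \<in> Xs" using Xs_nonempty .
  then show ?thesis using primal_solution[of X] psd_trace_nonneg[of X] by auto
qed

lemma F_ge:
  assumes "psd X" "trace X \<le> \<alpha>"
  shows "- (b \<bullet> y) + X \<bullet> (At y - C) \<le> F y"
proof -
  have "X \<bullet> (At y - C) \<le> trace X * violation y" by (rule inner_le_violation[OF assms(1)])
  also have "\<dots> \<le> \<alpha> * violation y" by (intro mult_right_mono assms violation_nonneg)
  finally show ?thesis by (simp add: F_eq)
qed

text \<open>The weight is \<open>\<alpha>\<close> if the largest eigenvalue is nonnegative and 0 otherwise, which accounts for the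
  maximum with 0 in the penalty.\<close>

lemma F_attained:
  assumes e: "eigen_decomp (At y - C) W \<mu>" and j: "\<mu> j = lambda_max (At y - C)"
  shows "\<exists>a. 0 \<le> a \<and> a \<le> \<alpha> \<and>
           F y = - (b \<bullet> y) + (a *\<^sub>R outer (column j W) (column j W)) \<bullet> (At y - C)"
proof -
  have "outer (column j W) (column j W) \<bullet> (At y - C) = lambda_max (At y - C)"
    by (simp add: inner_outer eigen_decomp_eigenvector[OF e] eigen_decomp_orthonormal[OF e] j)
  then show ?thesis using alpha_pos
    by (intro exI[of _ "if lambda_max (At y - C) \<ge> 0 then \<alpha> else 0"]) (auto simp: F_eq violation_def)
qed

lemma F_attained_psd:
  obtains X where "psd X" "trace X \<le> \<alpha>" "F y = - (b \<bullet> y) + X \<bullet> (At y - C)"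
proof -
  obtain W \<mu> where e: "eigen_decomp (At y - C) W \<mu>" using spectral_decomposition[OF slack_sym(2)] .
  have "Max (range \<mu>) \<in> range \<mu>" by (intro Max_in) auto
  then obtain j where "Max (range \<mu>) = \<mu> j" by blast
  then have j: "\<mu> j = lambda_max (At y - C)" by (simp add: lambda_max_eq_Max[OF e])
  obtain a where a: "0 \<le> a" "a \<le> \<alpha>"
    "F y = - (b \<bullet> y) + (a *\<^sub>R outer (column j W) (column j W)) \<bullet> (At y - C)"
    using F_attained[OF e j] by blast
  show ?thesis
    using a by (intro that[OF _ _ a(3)])
      (auto simp: psd_scale psd_outer trace_scaleR trace_outer eigen_decomp_orthonormal[OF e])
qed

text \<open>The inner product of a primal solution with \<open>\<A>\<^sup>* y - C\<close> equals \<open>\<langle>b, y\<rangle> + F\<^sup>*\<close>, and it is at most the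
  trace of the solution times the violation.\<close>

lemma exact_penalty:
  assumes "X \<in> Xs"
  shows "fopt + (\<alpha> - trace X) * violation y \<le> F y"
proof -
  have "X \<bullet> (At y - C) = b \<bullet> y + fopt"
    using primal_solution[OF assms] fopt_primal[OF assms] At_inner[of X y]
    by (simp add: inner_diff_right psd_sym inner_commute[of X C])
  then show ?thesis
    using inner_le_violation[of X y] primal_solution[OF assms] by (simp add: F_eq algebra_simps)
qed

lemma F_ge_fopt: "fopt \<le> F y"
proof -
  obtain X where X: "X \<in> Xs" using Xs_nonempty .
  then have "0 \<le> (\<alpha> - trace X) * violation y"
    using primal_solution[OF X] violation_nonneg by (intro mult_nonneg_nonneg) auto
  then show ?thesis using exact_penalty[OF X, of y] by linarith
qed

lemma violation_le_gap:
  obtains \<gamma> where "0 < \<gamma>" "\<And>y. violation y \<le> \<gamma> * (F y - fopt)"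
proof -
  obtain X where X: "X \<in> Xs" using Xs_nonempty .
  have pos: "0 < \<alpha> - trace X" using primal_solution[OF X] by simp
  then have "violation y \<le> (1 / (\<alpha> - trace X)) * (F y - fopt)" for y
    using exact_penalty[OF X, of y] by (simp add: field_simps)
  then show ?thesis using that[of "1 / (\<alpha> - trace X)"] pos by simp
qed

text \<open>The penalty is exact: a minimizer of \<open>F\<close> has no violation, because \<open>\<alpha>\<close> exceeds the trace of
  every primal solution.\<close>

lemma Ys_iff: "y \<in> Ys \<longleftrightarrow> F y = fopt"
proof
  assume y: "y \<in> Ys"
  then have "violation y = 0" by (simp add: dual_solutions_def dual_feasible_iff)
  then show "F y = fopt" using fopt_dual[OF y] by (simp add: F_eq)
next
  assume F: "F y = fopt"
  obtain \<gamma> where "0 < \<gamma>" "\<And>y. violation y \<le> \<gamma> * (F y - fopt)" using violation_le_gap by blast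
  from this(2)[of y] have v: "violation y = 0" using violation_nonneg[of y] F by simp
  obtain y0 where y0: "y0 \<in> Ys" using Ys_nonempty .
  then have "- (b \<bullet> y0) \<le> - (b \<bullet> y')" if "y' \<in> dual_feasible C A" for y'
    using that by (simp add: dual_solutions_def)
  moreover have "- (b \<bullet> y) = - (b \<bullet> y0)" using F v fopt_dual[OF y0] by (simp add: F_eq)
  ultimately show "y \<in> Ys" using v by (simp add: dual_solutions_def dual_feasible_iff)
qed

text \<open>A convex function is supported from below by affine functions; here those with slope
  matrices \<open>X \<succeq> 0\<close>, \<open>tr X \<le> \<alpha>\<close>, of which one is tight at each point.\<close>

lemma F_convex: "convex_on UNIV F"
proof (rule convex_onI)
  fix t :: real and x y :: "real^'m" assume t: "0 < t" "t < 1"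
  obtain X where X: "psd X" "trace X \<le> \<alpha>"
    "F ((1 - t) *\<^sub>R x + t *\<^sub>R y) =
       - (b \<bullet> ((1 - t) *\<^sub>R x + t *\<^sub>R y)) + X \<bullet> (At ((1 - t) *\<^sub>R x + t *\<^sub>R y) - C)"
    using F_attained_psd by blast
  have "At ((1 - t) *\<^sub>R x + t *\<^sub>R y) - C = (1 - t) *\<^sub>R (At x - C) + t *\<^sub>R (At y - C)"
    unfolding linear_add[OF At_linear] linear_scale[OF At_linear] by (simp add: algebra_simps)
  then have "F ((1 - t) *\<^sub>R x + t *\<^sub>R y) =
      (1 - t) * (- (b \<bullet> x) + X \<bullet> (At x - C)) + t * (- (b \<bullet> y) + X \<bullet> (At y - C))"
    using X(3) by (simp add: inner_add_right distrib_left right_diff_distrib)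
  also have "\<dots> \<le> (1 - t) * F x + t * F y"
    using t by (intro add_mono mult_left_mono F_ge X) auto
  finally show "F ((1 - t) *\<^sub>R x + t *\<^sub>R y) \<le> (1 - t) * F x + t * F y" .
qed simp

lemma F_segment:
  assumes "0 \<le> s" "s \<le> 1"
  shows "F (x + s *\<^sub>R (y - x)) \<le> F x - s * (F x - F y)"
proof -
  have "x + s *\<^sub>R (y - x) = (1 - s) *\<^sub>R x + s *\<^sub>R y" by (simp add: algebra_simps)
  then have "F (x + s *\<^sub>R (y - x)) \<le> (1 - s) * F x + s * F y"
    using convex_onD[OF F_convex, of s x y] assms by simp
  then show ?thesis by (simp add: algebra_simps)
qed

lemma F_continuous: "continuous_on S F"
  using convex_on_continuous[OF open_UNIV F_convex] continuous_on_subset by blast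

text \<open>On a sphere that encloses the compact set of minimizers, \<open>F\<close> exceeds \<open>F\<^sup>*\<close> by some \<open>m > 0\<close>, and
  convexity makes \<open>F\<close> grow at least linearly beyond it.\<close>

lemma sublevel_bounded:
  obtains R where "0 < R" "\<And>y. F y \<le> c \<Longrightarrow> norm y \<le> R"
proof -
  obtain y0 where y0: "y0 \<in> Ys" using Ys_nonempty .
  have "bounded Ys" using strong_duality by (simp add: strong_duality_def compact_imp_bounded)
  then obtain r where r: "\<And>y. y \<in> Ys \<Longrightarrow> dist y0 y \<le> r"
    using bounded_any_center[of Ys y0] by blast
  define \<rho> where "\<rho> = \<bar>r\<bar> + 1"
  have \<rho>: "0 < \<rho>" by (simp add: \<rho>_def)
  have "sphere y0 \<rho> \<noteq> {}" using \<rho> by simp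
  then obtain q where q: "q \<in> sphere y0 \<rho>" "\<And>y. y \<in> sphere y0 \<rho> \<Longrightarrow> F q \<le> F y"
    using continuous_attains_inf[OF compact_sphere _ F_continuous, of y0 \<rho>] by blast
  define m where "m = F q - fopt"
  have "q \<notin> Ys" using q(1) r[of q] by (auto simp: \<rho>_def)
  then have m: "0 < m" using F_ge_fopt[of q] by (simp add: m_def Ys_iff)
  have far: "dist y0 y \<le> \<rho> + \<rho> * \<bar>c - fopt\<bar> / m" if Fy: "F y \<le> c" for y
  proof (cases "dist y0 y \<le> \<rho>")
    case True
    then show ?thesis using \<rho> m by (intro order.trans[OF True]) auto
  next
    case False
    define d where "d = norm (y - y0)"
    have d: "\<rho> < d" using False by (simp add: d_def dist_norm norm_minus_commute)
    have "dist y0 (y0 + (\<rho> / d) *\<^sub>R (y - y0)) = \<rho>"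
      using d \<rho> by (simp add: dist_norm d_def[symmetric])
    then have "F q \<le> F (y0 + (\<rho> / d) *\<^sub>R (y - y0))" using q(2) by simp
    also have "\<dots> \<le> fopt - (\<rho> / d) * (fopt - F y)"
      using F_segment[of "\<rho> / d" y0 y] y0 d \<rho> by (simp add: Ys_iff)
    finally have "m \<le> (\<rho> / d) * (F y - fopt)" by (simp add: m_def algebra_simps)
    also have "\<dots> \<le> (\<rho> / d) * \<bar>c - fopt\<bar>" using Fy d \<rho> by (intro mult_left_mono) auto
    finally have "d \<le> \<rho> * \<bar>c - fopt\<bar> / m" using m d \<rho> by (simp add: field_simps)
    then show ?thesis using \<rho> by (simp add: d_def dist_norm norm_minus_commute)
  qed
  define R where "R = norm y0 + (\<rho> + \<rho> * \<bar>c - fopt\<bar> / m)"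
  have "0 < R" using \<rho> m unfolding R_def by (intro add_nonneg_pos add_pos_nonneg) auto
  moreover have "norm y \<le> R" if "F y \<le> c" for y
    using far[OF that] norm_triangle_sub[of y y0] by (simp add: R_def dist_norm norm_minus_commute)
  ultimately show ?thesis using that by blast
qed

end

section \<open>Quadratic growth under strict complementarity\<close>

text \<open>A Hoffman bound for linear equations: on the orthogonal complement of the kernel the map is
  injective, hence bounded below.\<close>

lemma linear_distance_to_kernel:
  fixes f :: "'a::euclidean_space \<Rightarrow> 'b::euclidean_space"
  assumes "linear f"
  obtains e where "0 < e" "\<And>d. \<exists>k. f k = 0 \<and> e * norm (d - k) \<le> norm (f d)"
proof -
  interpret linear f by fact
  define N where "N = {x. f x = 0}"
  have N: "subspace N" using assms by (simp add: N_def linear_subspace_kernel)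
  define P where "P = {x. \<forall>k\<in>N. orthogonal k x}"
  have P: "subspace P" unfolding P_def by (rule subspace_orthogonal_to_vectors)
  have "x = 0" if "x \<in> P" "f x = 0" for x
    using that by (auto simp: P_def N_def orthogonal_def)
  then have "\<forall>x\<in>P. f x = 0 \<longrightarrow> x = 0" by blast
  from injective_imp_isometric[OF closed_subspace[OF P] P assms[unfolded linear_conv_bounded_linear] this]
  obtain e where e: "e > 0" "\<forall>x\<in>P. norm (f x) \<ge> e * norm x" by blast
  have "\<exists>k. f k = 0 \<and> e * norm (d - k) \<le> norm (f d)" for d
  proof -
    obtain k w where kw: "k \<in> span N" "\<And>u. u \<in> span N \<Longrightarrow> orthogonal w u" "d = k + w"
      using orthogonal_subspace_decomp_exists[of N d] by metis
    then have "w \<in> P" "f k = 0"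
      using N by (auto simp: P_def N_def orthogonal_commute span_eq_iff[THEN iffD2])
    then show ?thesis using e kw by (intro exI[of _ k]) (auto simp: add)
  qed
  then show ?thesis using that e by blast
qed

context penalized_sdp
begin

text \<open>Complementarity gives \<open>Z(y) X = 0\<close>, so the range of \<open>X\<close> lies in the kernel of the slack; the rank
  condition makes the dimensions agree.\<close>

lemma strictly_complementary_slackness:
  assumes X: "X \<in> Xs" and y: "y \<in> Ys"
    and rank: "rank X + rank (slack y) = CARD('n)"
    and v: "slack y *v v = 0"
  obtains u where "v = X *v u"
proof -
  have Z: "psd (slack y)"
    using y by (simp add: dual_solutions_def dual_feasible_def loewner_le_def)
  note pX = primal_solution[OF X]
  have "X \<bullet> slack y = 0"
    using fopt_primal[OF X] fopt_dual[OF y] At_inner[OF psd_sym[OF pX(1)], of y] pX(2)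
    by (simp add: inner_diff_right inner_commute[of X C])
  then have ZX: "slack y ** X = 0" using psd_norm_mult_le[OF pX(1) Z] by simp
  have sub: "range ((*v) X) \<subseteq> {v. slack y *v v = 0}"
    using ZX by (auto simp: matrix_vector_mul_assoc)
  have "dim {v. slack y *v v = 0} = dim (range ((*v) X))"
    using rank symmetric_rank_nullity[OF slack_sym(1), of y] rank_dim_range[of X] by simp
  moreover have "subspace {v. slack y *v v = 0}" "subspace (range ((*v) X))"
    by (auto intro: linear_subspace_kernel linear_subspace_image[OF matrix_vector_mul_linear subspace_UNIV])
  ultimately have "range ((*v) X) = {v. slack y *v v = 0}"
    using sub by (intro subspace_dim_equal) auto
  then show ?thesis using v that by blast
qed

text \<open>Along a direction \<open>k\<close> with \<open>(\<A>\<^sup>* k) X = 0\<close> the dual objective is constant, so only feasibility is at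
  stake. The slack of the point below is, up to a positive factor, the matrix assumed to be
  positive semidefinite.\<close>

lemma dual_solution_by_shift:
  assumes X: "X \<in> Xs" and y: "y \<in> Ys" and k: "At k ** X = 0"
    and \<theta>: "0 \<le> \<theta>" and psd: "psd (slack (y + k) + \<theta> *\<^sub>R slack y)"
  shows "y + (1 / (1 + \<theta>)) *\<^sub>R k \<in> Ys"
proof -
  have "slack (y + k) + \<theta> *\<^sub>R slack y = (1 + \<theta>) *\<^sub>R slack y - At k"
    by (simp add: linear_add[OF At_linear] algebra_simps)
  then have "(1 / (1 + \<theta>)) *\<^sub>R (slack (y + k) + \<theta> *\<^sub>R slack y) = slack y - (1 / (1 + \<theta>)) *\<^sub>R At k"
    using \<theta> by (simp add: scaleR_diff_right add_nonneg_eq_0_iff)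
  also have "\<dots> = slack (y + (1 / (1 + \<theta>)) *\<^sub>R k)"
    unfolding linear_add[OF At_linear] linear_scale[OF At_linear] by simp
  finally have "psd (slack (y + (1 / (1 + \<theta>)) *\<^sub>R k))"
    using psd_scale[OF psd, of "1 / (1 + \<theta>)"] \<theta> by simp
  then have feas: "y + (1 / (1 + \<theta>)) *\<^sub>R k \<in> dual_feasible C A"
    by (simp add: dual_feasible_def loewner_le_def)
  have "b \<bullet> k = 0"
    using primal_solution[OF X] At_inner[of X k] inner_eq_trace_mult[OF At_sym, of X k] k
    by (simp add: psd_sym trace_def)
  then show ?thesis
    using feas fopt_dual[OF y] unfolding Ys_iff F_eq dual_feasible_iff by (simp add: inner_add_right)
qed

text \<open>The proof bounds four quantities in turn by multiples of \<open>r = \<epsilon>\<^sup>1\<^sup>/\<^sup>2\<close>, where \<open>\<epsilon> = F(y) - F\<^sup>*\<close>: the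
  violation \<open>s\<close> (constant \<open>s0\<close>), the norm of \<open>Z(y) X\<close> (\<open>K1\<close>), the distance from \<open>y\<close> to the affine space
  \<open>{u. Z(u) X = 0}\<close> (\<open>K2\<close>), and the weight \<open>\<theta>\<close> with which \<open>y\<^sub>*\<close> must be mixed in to restore feasibility (\<open>K4\<close>).
  On the sublevel set \<open>r \<le> g\<close>, so that terms of order \<open>\<epsilon> = r\<^sup>2\<close> are absorbed as well.\<close>

theorem quadratic_growth:
  assumes "strict_complementarity C A b"
  obtains K where "0 < K" "\<And>y. F y \<le> c \<Longrightarrow> \<exists>y'\<in>Ys. (norm (y - y'))\<^sup>2 \<le> K * (F y - fopt)"
proof -
  obtain X yS where X: "X \<in> Xs" and yS: "yS \<in> Ys"
    and rank: "rank X + rank (slack yS) = CARD('n)"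
    using assms by (auto simp: strict_complementarity_def)
  note pX = primal_solution[OF X]
  have psdZ: "psd (slack yS)"
    using yS by (simp add: dual_solutions_def dual_feasible_def loewner_le_def)
  have XZ: "X \<bullet> slack y = F y - fopt - \<alpha> * violation y" for y
  proof -
    have "X \<bullet> C = - fopt" using fopt_primal[OF X] by (simp add: inner_commute)
    moreover have "X \<bullet> At y = b \<bullet> y" using At_inner[OF psd_sym[OF pX(1)], of y] pX(2) by simp
    ultimately show ?thesis by (simp add: F_eq inner_diff_right)
  qed
  have "slack yS ** X = 0"
    using psd_norm_mult_le[OF pX(1) psdZ] XZ[of yS] yS
    by (simp add: Ys_iff[THEN iffD1] dual_solutions_def dual_feasible_iff)
  note ZSX = this
  obtain R where R: "0 < R" "\<And>y. F y \<le> c \<Longrightarrow> norm y \<le> R" using sublevel_bounded by blast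
  obtain B where B: "0 < B" "\<And>y. norm (At y) \<le> B * norm y" using At_bounded by blast
  obtain \<gamma> where \<gamma>: "0 < \<gamma>" "\<And>y. violation y \<le> \<gamma> * (F y - fopt)" using violation_le_gap by blast
  have linT: "linear (\<lambda>d. At d ** X)"
    by (rule linearI)
      (simp_all add: linear_add[OF At_linear] linear_scale[OF At_linear] matrix_add_rdistrib matrix_scaleR_left)
  obtain e where e: "0 < e" "\<And>d. \<exists>k. At k ** X = 0 \<and> e * norm (d - k) \<le> norm (At d ** X)"
    using linear_distance_to_kernel[OF linT] by blast
  obtain e' where e': "0 < e'"
    "\<And>v. \<exists>k. slack yS *v k = 0 \<and> e' * norm (v - k) \<le> norm (slack yS *v v)"
    using linear_distance_to_kernel[OF matrix_vector_mul_linear[of "slack yS"]] by blast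
  define g where "g = sqrt \<bar>c - fopt\<bar>"
  define s0 where "s0 = \<gamma> * g"
  define T0 where "T0 = (norm C + B * R + s0 * g * norm (mat 1 :: real^'n^'n)) * norm (mat 1 :: real^'n^'n)"
  define K1 where "K1 = sqrt (trace X * T0) + s0 * norm X"
  define K2 where "K2 = K1 / e"
  define K3 where "K3 = s0 + B * K2"
  define K4 where "K4 = trace (slack yS) / e'\<^sup>2 * K3"
  define K5 where "K5 = K2 + K4 * (R + norm yS + K2 * g)"
  have g: "0 \<le> g" by (simp add: g_def)
  have s0: "0 \<le> s0" using \<gamma> g by (simp add: s0_def)
  have T0: "0 \<le> T0" using B R s0 g by (simp add: T0_def)
  have K1: "0 \<le> K1" using T0 s0 psd_trace_nonneg[OF pX(1)] by (simp add: K1_def)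
  have K2: "0 \<le> K2" using K1 e by (simp add: K2_def)
  have K3: "0 \<le> K3" using s0 K2 B by (simp add: K3_def)
  have K4: "0 \<le> K4" using K3 psd_trace_nonneg[OF psdZ] by (simp add: K4_def)
  have K5: "0 \<le> K5" using K2 K4 R g by (simp add: K5_def)
  have main: "\<exists>y'\<in>Ys. (norm (y - y'))\<^sup>2 \<le> (K5\<^sup>2 + 1) * (F y - fopt)" if Fy: "F y \<le> c" for y
  proof -
    define \<epsilon> where "\<epsilon> = F y - fopt"
    define r where "r = sqrt \<epsilon>"
    have eps: "0 \<le> \<epsilon>" using F_ge_fopt[of y] by (simp add: \<epsilon>_def)
    have r: "0 \<le> r" "r\<^sup>2 = \<epsilon>" using eps by (auto simp: r_def)
    have rg: "r \<le> g" unfolding r_def g_def \<epsilon>_def using Fy by (intro real_sqrt_le_mono) auto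
    define s where "s = violation y"
    have s: "0 \<le> s" by (simp add: s_def violation_nonneg)
    have sr: "s \<le> s0 * r"
    proof -
      have "s \<le> \<gamma> * (r * r)" using \<gamma>(2)[of y] r by (simp add: s_def \<epsilon>_def[symmetric] power2_eq_square)
      also have "\<dots> \<le> \<gamma> * (g * r)" using \<gamma> rg r by (intro mult_left_mono mult_right_mono) auto
      finally show ?thesis by (simp add: s0_def mult.assoc)
    qed
    \<comment> \<open>The least shift of the slack that makes it positive semidefinite at an infeasible point.\<close>
    define Z where "Z = slack y + s *\<^sub>R mat 1"
    have Zpsd: "psd Z" unfolding Z_def s_def by (rule slack_shift_psd)
    have XZ': "X \<bullet> Z \<le> \<epsilon>"
    proof -
      have "X \<bullet> Z = \<epsilon> - (\<alpha> - trace X) * s"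
        unfolding Z_def inner_add_right XZ inner_scaleR_right trace_eq_inner[symmetric]
        by (simp add: \<epsilon>_def s_def left_diff_distrib mult.commute)
      moreover have "0 \<le> (\<alpha> - trace X) * s" using pX(3) s by (intro mult_nonneg_nonneg) auto
      ultimately show ?thesis by linarith
    qed
    have trZ: "trace Z \<le> T0"
    proof -
      have "trace Z \<le> norm Z * norm (mat 1 :: real^'n^'n)"
        unfolding trace_eq_inner by (rule norm_cauchy_schwarz)
      moreover have "norm Z \<le> norm C + B * R + s0 * g * norm (mat 1 :: real^'n^'n)"
      proof -
        have "norm Z \<le> norm (slack y) + norm (s *\<^sub>R (mat 1 :: real^'n^'n))"
          unfolding Z_def by (rule norm_triangle_ineq)
        moreover have "norm (slack y) \<le> norm C + norm (At y)" by (rule norm_triangle_ineq4)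
        moreover have "norm (At y) \<le> B * R"
          using B(2)[of y] mult_left_mono[OF R(2)[OF Fy], of B] B(1) by linarith
        moreover have "norm (s *\<^sub>R (mat 1 :: real^'n^'n)) \<le> s0 * g * norm (mat 1 :: real^'n^'n)"
        proof -
          have "s \<le> s0 * g" using sr mult_left_mono[OF rg s0] by linarith
          then show ?thesis using s by (simp add: mult_right_mono)
        qed
        ultimately show ?thesis by linarith
      qed
      ultimately show ?thesis unfolding T0_def
        by (meson mult_right_mono norm_ge_zero order_trans)
    qed
    have "norm (slack y ** X) \<le> K1 * r"
    proof -
      have "(norm (Z ** X))\<^sup>2 \<le> trace X * trace Z * (X \<bullet> Z)" by (rule psd_norm_mult_le[OF pX(1) Zpsd])
      also have "\<dots> \<le> trace X * T0 * \<epsilon>"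
        using psd_trace_nonneg[OF pX(1)] psd_trace_nonneg[OF Zpsd] psd_inner_nonneg[OF pX(1) Zpsd] trZ XZ' T0
        by (intro mult_mono) auto
      finally have "norm (Z ** X) \<le> sqrt (trace X * T0 * \<epsilon>)" by (rule real_le_rsqrt)
      then have "norm (Z ** X) \<le> sqrt (trace X * T0) * r" by (simp add: real_sqrt_mult r_def)
      moreover have "slack y ** X = Z ** X - s *\<^sub>R X"
      proof -
        have "Z ** X = slack y ** X + s *\<^sub>R X"
          by (simp add: Z_def matrix_add_rdistrib matrix_scaleR_left)
        then show ?thesis by simp
      qed
      then have "norm (slack y ** X) \<le> norm (Z ** X) + s * norm X"
        using norm_triangle_ineq4[of "Z ** X" "s *\<^sub>R X"] s by simp
      moreover have "s * norm X \<le> s0 * norm X * r"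
        using mult_right_mono[OF sr, of "norm X"] by (simp add: mult_ac)
      ultimately show ?thesis by (simp add: K1_def distrib_right)
    qed
    moreover have "At (y - yS) ** X = - (slack y ** X)"
    proof -
      have "At (y - yS) + slack y = slack yS" by (simp add: linear_diff[OF At_linear])
      then have "At (y - yS) ** X + slack y ** X = 0" using ZSX by (metis matrix_add_rdistrib)
      then show ?thesis by (simp add: eq_neg_iff_add_eq_0)
    qed
    ultimately have TX: "norm (At (y - yS) ** X) \<le> K1 * r" by simp
    \<comment> \<open>The point \<open>yS + k\<close> satisfies \<open>slack (yS + k) ** X = 0\<close>.\<close>
    obtain k where k: "At k ** X = 0" "e * norm ((y - yS) - k) \<le> norm (At (y - yS) ** X)"
      using e(2) by blast
    have yk: "norm (y - (yS + k)) \<le> K2 * r"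
      using k(2) TX e(1) by (simp add: K2_def field_simps diff_diff_eq)
    define \<theta> where "\<theta> = K4 * r"
    have \<theta>: "0 \<le> \<theta>" using K4 r by (simp add: \<theta>_def)
    have low: "- (K3 * r) * (w \<bullet> w) \<le> w \<bullet> (slack (yS + k) *v w)" for w
    proof -
      define D where "D = At (y - (yS + k))"
      have "slack (yS + k) = (Z - s *\<^sub>R mat 1) + D"
        by (simp add: Z_def D_def linear_diff[OF At_linear])
      then have "w \<bullet> (slack (yS + k) *v w) = w \<bullet> (Z *v w) - s * (w \<bullet> w) + w \<bullet> (D *v w)"
        by (simp add: matrix_vector_mult_add_rdistrib matrix_vector_mult_diff_rdistrib inner_add_right
            inner_diff_right scaleR_matrix_vector_assoc[symmetric])
      moreover have "0 \<le> w \<bullet> (Z *v w)" by (rule psd_quad[OF Zpsd])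
      moreover have "s * (w \<bullet> w) \<le> s0 * r * (w \<bullet> w)" using sr by (simp add: mult_right_mono)
      moreover have "- (B * K2 * r * (w \<bullet> w)) \<le> w \<bullet> (D *v w)"
      proof -
        have "norm D \<le> B * (K2 * r)"
          using B(2)[of "y - (yS + k)"] mult_left_mono[OF yk, of B] B(1) unfolding D_def by linarith
        then have "norm D * (w \<bullet> w) \<le> B * (K2 * r) * (w \<bullet> w)" by (simp add: mult_right_mono)
        then show ?thesis using quad_le_norm[of w D] by (simp add: mult.assoc)
      qed
      ultimately show ?thesis by (simp add: K3_def algebra_simps)
    qed
    have "psd (slack (yS + k) + \<theta> *\<^sub>R slack yS)"
      unfolding psd_def
    proof (intro conjI allI)
      show "slack (yS + k) + \<theta> *\<^sub>R slack yS \<in> sym_mats"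
        by (intro sym_mats_add sym_mats_scale slack_sym)
      fix v :: "real^'n"
      \<comment> \<open>Modulo the kernel of \<open>slack yS\<close>, which \<open>slack (yS + k)\<close> annihilates as well, the negative part of
          \<open>slack (yS + k)\<close> is dominated by a multiple of \<open>slack yS\<close>.\<close>
      obtain q where q: "slack yS *v q = 0" "e' * norm (v - q) \<le> norm (slack yS *v v)"
        using e'(2) by blast
      obtain u where u: "q = X *v u"
        using strictly_complementary_slackness[OF X yS rank q(1)] by blast
      define w where "w = v - q"
      have "slack (yS + k) ** X = 0"
      proof -
        have "slack (yS + k) + At k = slack yS" by (simp add: linear_add[OF At_linear])
        then have "slack (yS + k) ** X + At k ** X = 0" using ZSX by (metis matrix_add_rdistrib)
        then show ?thesis using k(1) by simp
      qed
      then have q0: "slack (yS + k) *v q = 0" by (simp add: u matrix_vector_mul_assoc)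
      have quad: "v \<bullet> (slack (yS + k) *v v) = w \<bullet> (slack (yS + k) *v w)"
      proof -
        have "v = q + w" by (simp add: w_def)
        moreover have "q \<bullet> (slack (yS + k) *v w) = 0"
          using sym_mats_inner[OF slack_sym(1), of "yS + k" q w] q0 by simp
        ultimately show ?thesis by (simp add: matrix_vector_right_distrib q0 inner_add_left)
      qed
      have "(e' * norm w)\<^sup>2 \<le> (norm (slack yS *v v))\<^sup>2"
        using q(2) e'(1) unfolding w_def by (intro power_mono) auto
      also have "\<dots> \<le> trace (slack yS) * (v \<bullet> (slack yS *v v))"
        by (rule psd_mult_vec_bound[OF psdZ])
      finally have ww: "w \<bullet> w \<le> trace (slack yS) / e'\<^sup>2 * (v \<bullet> (slack yS *v v))"
        using e'(1) by (simp add: power_mult_distrib dot_square_norm field_simps)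
      have "K3 * r * (w \<bullet> w) \<le> K3 * r * (trace (slack yS) / e'\<^sup>2 * (v \<bullet> (slack yS *v v)))"
        using K3 r ww by (intro mult_left_mono) auto
      also have "\<dots> = \<theta> * (v \<bullet> (slack yS *v v))" by (simp add: \<theta>_def K4_def mult_ac)
      finally show "0 \<le> v \<bullet> ((slack (yS + k) + \<theta> *\<^sub>R slack yS) *v v)"
        using low[of w] quad
        by (simp add: matrix_vector_mult_add_rdistrib inner_add_right scaleR_matrix_vector_assoc[symmetric])
    qed
    then have y': "yS + (1 / (1 + \<theta>)) *\<^sub>R k \<in> Ys"
      by (rule dual_solution_by_shift[OF X yS k(1) \<theta>])
    have "norm (y - (yS + (1 / (1 + \<theta>)) *\<^sub>R k)) \<le> K5 * r"
    proof -
      have "1 - 1 / (1 + \<theta>) = \<theta> / (1 + \<theta>)" using \<theta> by (simp add: field_simps)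
      then have kk: "k - (1 / (1 + \<theta>)) *\<^sub>R k = (\<theta> / (1 + \<theta>)) *\<^sub>R k"
        by (metis scaleR_left_diff_distrib scaleR_one)
      have "y - (yS + (1 / (1 + \<theta>)) *\<^sub>R k) = (y - (yS + k)) + (k - (1 / (1 + \<theta>)) *\<^sub>R k)"
        by simp
      then have "y - (yS + (1 / (1 + \<theta>)) *\<^sub>R k) = (y - (yS + k)) + (\<theta> / (1 + \<theta>)) *\<^sub>R k"
        unfolding kk .
      then have "norm (y - (yS + (1 / (1 + \<theta>)) *\<^sub>R k)) \<le> norm (y - (yS + k)) + (\<theta> / (1 + \<theta>)) * norm k"
        using norm_triangle_ineq[of "y - (yS + k)" "(\<theta> / (1 + \<theta>)) *\<^sub>R k"] \<theta>
        by (simp only: norm_scaleR) simp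
      moreover have "(\<theta> / (1 + \<theta>)) * norm k \<le> \<theta> * (R + norm yS + K2 * g)"
      proof (rule mult_mono)
        show "\<theta> / (1 + \<theta>) \<le> \<theta>" using \<theta> by (simp add: field_simps)
        have "norm k \<le> norm y + norm yS + norm (y - (yS + k))"
          using norm_triangle_ineq4[of "y - yS" "y - (yS + k)"] norm_triangle_ineq4[of y yS] by simp
        moreover have "K2 * r \<le> K2 * g" using rg K2 by (rule mult_left_mono)
        ultimately show "norm k \<le> R + norm yS + K2 * g" using R(2)[OF Fy] yk by linarith
      qed (use \<theta> in auto)
      ultimately have "norm (y - (yS + (1 / (1 + \<theta>)) *\<^sub>R k)) \<le> K2 * r + \<theta> * (R + norm yS + K2 * g)"
        using yk by linarith
      then show ?thesis by (simp add: K5_def \<theta>_def algebra_simps)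
    qed
    then have "(norm (y - (yS + (1 / (1 + \<theta>)) *\<^sub>R k)))\<^sup>2 \<le> (K5 * r)\<^sup>2" by (intro power_mono) auto
    also have "\<dots> \<le> (K5\<^sup>2 + 1) * \<epsilon>" using r eps by (simp add: power_mult_distrib distrib_right)
    finally show ?thesis using y' unfolding \<epsilon>_def by blast
  qed
  have "0 < K5\<^sup>2 + 1" by (simp add: add_nonneg_pos)
  then show ?thesis using that main by blast
qed

end

section \<open>The spectral bundle method\<close>

locale specbm = penalized_sdp C A b \<alpha>
  for C :: "real^'n^'n" and A :: "real^'n^'n \<Rightarrow> real^'m" and b :: "real^'m" and \<alpha> :: real +
  fixes rp rc :: nat and \<beta> \<rho> :: real and V0 :: "real^'r^'n" and y0 :: "real^'m"
    and y z :: "nat \<Rightarrow> real^'m" and Xbar X :: "nat \<Rightarrow> real^'n^'n"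
    and V :: "nat \<Rightarrow> real^'r^'n" and p :: "nat \<Rightarrow> real \<times> (real^'r^'r)"
  assumes rc: "rc \<ge> 1" and beta: "0 < \<beta>" "\<beta> < 1" and rho: "\<rho> > 0"
    and V0: "orthonormal_columns V0"
    and run: "specbm_run C A b rp rc \<beta> \<rho> \<alpha> V0 y0 y z Xbar V p X"
begin

text \<open>The proximal Lagrangian as a function of the primal matrix itself; its restriction to the set
  \<open>model t\<close> below is the one in the subproblem of iteration \<open>t\<close>.\<close>

definition L :: "nat \<Rightarrow> real^'m \<Rightarrow> real^'n^'n \<Rightarrow> real" where
  "L t w Y = - (b \<bullet> w) + Y \<bullet> (At w - C) + \<rho> / 2 * (norm (w - y t))\<^sup>2"

definition model :: "nat \<Rightarrow> (real^'n^'n) set" where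
  "model t = model_matrix (Xbar t) (V t) ` model_set \<alpha> (Xbar t)"

lemma Xbar_0: "Xbar 0 = 0" and V_0: "V 0 = V0"
  and saddle: "saddle_point C A b \<rho> \<alpha> (Xbar t) (V t) (y t) (z (Suc t)) (p t)"
  and X_eq: "X t = model_matrix (Xbar t) (V t) (p t)"
  and y_Suc: "y (Suc t) =
            (if \<beta> * (F (y t) - spectral_model C A b \<alpha> (Xbar t) (V t) (z (Suc t)))
                \<le> F (y t) - F (z (Suc t)) then z (Suc t) else y t)"
  and update: "bundle_update C A rp rc (Xbar t) (V t) (z (Suc t)) (p t) (Xbar (Suc t)) (V (Suc t))"
  using run by (simp_all add: specbm_run_def)

lemma V_orthonormal: "orthonormal_columns (V t)"
proof (cases t)
  case 0
  then show ?thesis by (simp add: V_0 V0)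
next
  case (Suc t')
  then show ?thesis using update[of t'] by (auto simp: bundle_update_def)
qed

lemma X_in_model: "X t \<in> model t"
  and X_maximal: "Y \<in> model t \<Longrightarrow> L t (z (Suc t)) Y \<le> L t (z (Suc t)) (X t)"
  and z_minimal: "L t (z (Suc t)) (X t) \<le> L t w (X t)"
  using saddle[of t] by (auto simp: saddle_point_def prox_lagrangian_def model_def L_def X_eq)

lemma p_feasible: "0 \<le> fst (p t)" "psd (snd (p t))"
    "fst (p t) * trace (Xbar t) + trace (snd (p t)) \<le> \<alpha>"
  using saddle[of t] by (auto simp: saddle_point_def model_set_def case_prod_beta)

text \<open>The discarded part has nonnegative eigenvalues because \<open>S\<^sub>t\<close> is positive semidefinite.\<close>

lemma Xbar_psd: "psd (Xbar t)"
proof (induction t)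
  case (Suc t)
  obtain Q d I where e: "eigen_decomp (snd (p t)) Q d"
    and X': "Xbar (Suc t) = fst (p t) *\<^sub>R Xbar t +
          V t ** (Q ** diag_mat (\<lambda>i. if i \<in> I then 0 else d i) ** transpose Q) ** transpose (V t)"
    using update[of t] unfolding bundle_update_def by blast
  have "psd (Q ** diag_mat (\<lambda>i. if i \<in> I then 0 else d i) ** transpose Q)"
    unfolding sandwich_diag using psd_eigen_nonneg[OF p_feasible(2) e]
    by (intro psd_sum psd_scale psd_outer) auto
  then show ?case unfolding X'
    using Suc p_feasible(1) by (intro psd_add psd_scale psd_sandwich[of "Q ** _ ** _"])
qed (simp add: Xbar_0 psd_0)

lemma model_psd: assumes "Y \<in> model t" shows "psd Y" "trace Y \<le> \<alpha>"
proof -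
  obtain \<eta> S where *: "Y = \<eta> *\<^sub>R Xbar t + V t ** S ** transpose (V t)" "0 \<le> \<eta>" "psd S"
      "\<eta> * trace (Xbar t) + trace S \<le> \<alpha>"
    using assms by (auto simp: model_def model_set_def model_matrix_def)
  show "psd Y" unfolding *(1) by (intro psd_add psd_scale psd_sandwich Xbar_psd *)
  show "trace Y \<le> \<alpha>"
    using * by (simp add: trace_add trace_scaleR trace_orthonormal_sandwich[OF V_orthonormal])
qed

lemmas X_psd = model_psd(1)[OF X_in_model] and X_trace = model_psd(2)[OF X_in_model]

lemma zero_in_model: "0 \<in> model t"
  unfolding model_def using alpha_pos
  by (intro image_eqI[of _ _ "(0, 0)"])
    (auto simp: model_matrix_def model_set_def psd_0 trace_eq_inner matrix_matrix_mult_def vec_eq_iff)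

text \<open>The update of the bundle is designed for this. The matrix \<open>X\<^sub>t\<close> is the new aggregate matrix with
  weight 1 plus a part carried by the retained eigenvectors, which lie in the span of the new
  basis; that basis also represents the top eigenprojection that gives a subgradient of \<open>F\<close> at \<open>z\<^sub>t\<^sub>+\<^sub>1\<close>; and the weights \<open>1 - s\<close> and \<open>s\<close> respect the trace constraint.\<close>

lemma cut_in_next_model:
  obtains W where "psd W" "trace W \<le> \<alpha>"
    "F (z (Suc t)) = - (b \<bullet> z (Suc t)) + W \<bullet> (At (z (Suc t)) - C)"
    "\<And>s. 0 \<le> s \<Longrightarrow> s \<le> 1 \<Longrightarrow> (1 - s) *\<^sub>R X t + s *\<^sub>R W \<in> model (Suc t)"
proof -
  obtain Q d I W \<mu> J where e: "eigen_decomp (snd (p t)) Q d"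
    and X': "Xbar (Suc t) = fst (p t) *\<^sub>R Xbar t +
          V t ** (Q ** diag_mat (\<lambda>i. if i \<in> I then 0 else d i) ** transpose Q) ** transpose (V t)"
    and eW: "eigen_decomp (At (z (Suc t)) - C) W \<mu>" and top: "top_indices \<mu> rc J"
    and sp: "(\<lambda>j. column j W) ` J \<union> (\<lambda>i. column i (V t ** Q)) ` I \<subseteq> span (columns (V (Suc t)))"
    using update[of t] unfolding bundle_update_def by blast
  note ON = V_orthonormal[of "Suc t"]
  note d0 = psd_eigen_nonneg[OF p_feasible(2) e]
  \<comment> \<open>The top eigenvectors include one for the largest eigenvalue, because \<open>rc \<ge> 1\<close>.\<close>
  obtain j where j: "j \<in> J" "\<mu> j = lambda_max (At (z (Suc t)) - C)"
  proof -
    have "J \<noteq> {}" using top rc by (auto simp: top_indices_def)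
    have "Max (range \<mu>) \<in> range \<mu>" by (intro Max_in) auto
    then obtain i where "Max (range \<mu>) = \<mu> i" by blast
    then have i: "\<mu> i = lambda_max (At (z (Suc t)) - C)" by (simp add: lambda_max_eq_Max[OF eW])
    show ?thesis
    proof (cases "i \<in> J")
      case False
      obtain j where "j \<in> J" using \<open>J \<noteq> {}\<close> by blast
      then have "\<mu> i \<le> \<mu> j" using top False by (auto simp: top_indices_def)
      then show ?thesis using that[OF \<open>j \<in> J\<close>] i eigen_le_lambda_max[OF eW, of j] by linarith
    qed (use i that in blast)
  qed
  obtain a where a: "0 \<le> a" "a \<le> \<alpha>"
    "F (z (Suc t)) = - (b \<bullet> z (Suc t)) + (a *\<^sub>R outer (column j W) (column j W)) \<bullet> (At (z (Suc t)) - C)"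
    using F_attained[OF eW j(2)] by blast
  define v where "v = column j W"
  have v: "v \<bullet> v = 1" "v \<in> span (columns (V (Suc t)))"
    using sp j by (auto simp: v_def eigen_decomp_orthonormal[OF eW])
  define u where "u i = column i (V t ** Q)" for i
  have u: "u i \<in> span (columns (V (Suc t)))" if "i \<in> I" for i
    using sp that by (auto simp: u_def)
  define N where "N = (\<Sum>i\<in>I. d i *\<^sub>R outer (u i) (u i))"
  have sand: "V t ** (Q ** diag_mat f ** transpose Q) ** transpose (V t)
      = (\<Sum>i\<in>UNIV. f i *\<^sub>R outer (u i) (u i))" for f
    by (simp add: sandwich_diag matrix_mult_sum_right matrix_mult_sum_left matrix_scaleR_right
        matrix_scaleR_left mult_outer outer_mult_transpose u_def column_mult)
  \<comment> \<open>The indices outside \<open>I\<close> have moved into the aggregate matrix.\<close>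
  have XN: "X t = Xbar (Suc t) + N"
  proof -
    have "snd (p t) = Q ** diag_mat d ** transpose Q" using e by (simp add: eigen_decomp_def)
    then have "X t = fst (p t) *\<^sub>R Xbar t + (\<Sum>i\<in>UNIV. d i *\<^sub>R outer (u i) (u i))"
      by (simp add: X_eq model_matrix_def case_prod_beta sand)
    moreover have "Xbar (Suc t) = fst (p t) *\<^sub>R Xbar t
        + (\<Sum>i\<in>UNIV. (if i \<in> I then 0 else d i) *\<^sub>R outer (u i) (u i))"
      unfolding X' sand ..
    moreover have "N = (\<Sum>i\<in>UNIV. (if i \<in> I then d i else 0) *\<^sub>R outer (u i) (u i))"
      unfolding N_def by (intro sum.mono_neutral_cong_left) auto
    ultimately show ?thesis
      by (simp add: add.assoc sum.distrib[symmetric] scaleR_add_left[symmetric] if_distrib cong: if_cong)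
        (rule sum.cong; simp)
  qed
  define T where "T v = transpose (V (Suc t)) *v v" for v
  define S where "S s = (1 - s) *\<^sub>R (\<Sum>i\<in>I. d i *\<^sub>R outer (T (u i)) (T (u i)))
      + (s * a) *\<^sub>R outer (T v) (T v)" for s
  have S: "V (Suc t) ** S s ** transpose (V (Suc t)) = (1 - s) *\<^sub>R N + (s * a) *\<^sub>R outer v v" for s
  proof -
    have "V (Suc t) ** outer (T (u i)) (T (u i)) ** transpose (V (Suc t)) = outer (u i) (u i)"
      if "i \<in> I" for i
      unfolding T_def by (rule orthonormal_columns_outer[OF ON u[OF that]])
    moreover have "V (Suc t) ** outer (T v) (T v) ** transpose (V (Suc t)) = outer v v"
      unfolding T_def by (rule orthonormal_columns_outer[OF ON v(2)])
    ultimately show ?thesis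
      by (simp add: S_def N_def matrix_add_ldistrib matrix_add_rdistrib matrix_scaleR_right
          matrix_scaleR_left matrix_mult_sum_right matrix_mult_sum_left cong: sum.cong)
  qed
  have mem: "(1 - s) *\<^sub>R X t + s *\<^sub>R (a *\<^sub>R outer v v) \<in> model (Suc t)" if s: "0 \<le> s" "s \<le> 1" for s
    unfolding model_def
  proof (rule image_eqI[of _ _ "(1 - s, S s)"])
    show "(1 - s) *\<^sub>R X t + s *\<^sub>R (a *\<^sub>R outer v v)
        = model_matrix (Xbar (Suc t)) (V (Suc t)) (1 - s, S s)"
      unfolding model_matrix_def prod.case S XN by (simp add: scaleR_add_right)
    have "psd (S s)" unfolding S_def
      using s a d0 by (intro psd_add psd_scale psd_sum psd_outer) auto
    moreover have "(1 - s) * trace (Xbar (Suc t)) + trace (S s) \<le> \<alpha>"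
    proof -
      have "trace (S s) = (1 - s) * trace N + s * a"
        using trace_orthonormal_sandwich[OF ON, of "S s"]
        by (simp add: S trace_add trace_scaleR trace_outer v)
      then have "(1 - s) * trace (Xbar (Suc t)) + trace (S s) = (1 - s) * trace (X t) + s * a"
        by (simp add: XN trace_add distrib_left)
      also have "\<dots> \<le> (1 - s) * \<alpha> + s * \<alpha>"
        using s a X_trace by (intro add_mono mult_left_mono) auto
      finally show ?thesis by (simp add: left_diff_distrib)
    qed
    ultimately show "(1 - s, S s) \<in> model_set \<alpha> (Xbar (Suc t))" using s by (simp add: model_set_def)
  qed
  show ?thesis
    using a v by (intro that[OF _ _ _ mem]) (auto simp: psd_scale psd_outer trace_scaleR trace_outer v_def)
qed

lemma affine_shift: "Y \<in> sym_mats \<Longrightarrow>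
    - (b \<bullet> w) + Y \<bullet> (At w - C) = - (b \<bullet> u) + Y \<bullet> (At u - C) + (A Y - b) \<bullet> (w - u)"
  by (simp add: inner_diff_right inner_diff_left At_inner)

lemma norm_shift:
  "(norm (w - v))\<^sup>2 = (norm (w - u))\<^sup>2 + 2 * ((u - v) \<bullet> (w - u)) + (norm (u - v))\<^sup>2" for u v w :: "real^'m"
proof -
  have "w - v = (w - u) + (u - v)" by simp
  then show ?thesis
    by (simp only: power2_norm_eq_inner inner_add_left inner_add_right inner_commute[of "w - u" "u - v"])
qed

lemma L_shift:
  assumes "Y \<in> sym_mats"
  shows "L t w Y = L t u Y + (A Y - b + \<rho> *\<^sub>R (u - y t)) \<bullet> (w - u) + \<rho> / 2 * (norm (w - u))\<^sup>2"
  unfolding L_def affine_shift[OF assms, of w u] norm_shift[of w "y t" u]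
  by (simp add: inner_add_left algebra_simps)

text \<open>First-order optimality of \<open>z\<^sub>t\<^sub>+\<^sub>1\<close> for the quadratic function \<open>L t _ (X t)\<close>.\<close>

lemma residual: "b - A (X t) = \<rho> *\<^sub>R (z (Suc t) - y t)"
proof -
  define g where "g = A (X t) - b + \<rho> *\<^sub>R (z (Suc t) - y t)"
  have "0 \<le> g \<bullet> h + \<rho> / 2 * (norm h)\<^sup>2" for h
    using z_minimal[of t "z (Suc t) + h"] L_shift[OF psd_sym[OF X_psd], of t "z (Suc t) + h" t "z (Suc t)"]
    by (simp add: g_def)
  \<comment> \<open>The minimizer of the quadratic in \<open>h\<close>.\<close>
  from this[of "- (1 / \<rho>) *\<^sub>R g"] have "(norm g)\<^sup>2 / (2 * \<rho>) \<le> 0"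
    using rho by (simp add: power_mult_distrib power2_norm_eq_inner[symmetric] field_simps power2_eq_square)
  then have "(norm g)\<^sup>2 \<le> 0" using rho by (simp add: divide_le_0_iff)
  then have "g = 0" by simp
  then show ?thesis by (simp add: g_def algebra_simps)
qed

lemma L_X: "L t w (X t) = L t (z (Suc t)) (X t) + \<rho> / 2 * (norm (w - z (Suc t)))\<^sup>2"
proof -
  have "A (X t) - b + \<rho> *\<^sub>R (z (Suc t) - y t) = 0" by (simp flip: residual)
  then show ?thesis using L_shift[OF psd_sym[OF X_psd], of t w t "z (Suc t)"] by simp
qed

lemma L_le_F: "psd Y \<Longrightarrow> trace Y \<le> \<alpha> \<Longrightarrow> L t w Y \<le> F w + \<rho> / 2 * (norm (w - y t))\<^sup>2"
  using F_ge[of Y w] by (simp add: L_def)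

text \<open>This quantity and the model gap \<open>F (y t) - model_value t\<close> agree up to a factor of 2. It is the
  better progress measure, because saddle values can be compared between consecutive iterations.\<close>

definition \<Delta> :: "nat \<Rightarrow> real" where
  "\<Delta> t = F (y t) - L t (z (Suc t)) (X t)"

definition model_value :: "nat \<Rightarrow> real" where
  "model_value t = - (b \<bullet> z (Suc t)) + X t \<bullet> (At (z (Suc t)) - C)"

text \<open>The supremum is attained at the saddle point, since the proximal term does not depend on the
  inner variable.\<close>

lemma spectral_model_eq: "spectral_model C A b \<alpha> (Xbar t) (V t) (z (Suc t)) = model_value t"
proof -
  have "p t \<in> model_set \<alpha> (Xbar t)" using saddle[of t] by (simp add: saddle_point_def)
  then show ?thesis
    unfolding spectral_model_def model_value_def
    using X_maximal[of _ t]
    by (intro cSup_eq_maximum) (auto simp: X_eq model_def L_def intro!: image_eqI)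
qed

text \<open>The function \<open>L t _ (X t)\<close> is \<open>\<rho>\<close>-strongly convex with minimizer \<open>z\<^sub>t\<^sub>+\<^sub>1\<close>, and at \<open>y\<^sub>t\<close> it is at most
  \<open>F(y\<^sub>t)\<close>.\<close>

lemma step_le_Delta: "\<rho> / 2 * (norm (z (Suc t) - y t))\<^sup>2 \<le> \<Delta> t"
  using L_X[of t "y t"] L_le_F[OF X_psd X_trace, of t "y t" t]
  by (simp add: \<Delta>_def norm_minus_commute)

lemma model_gap: "F (y t) - model_value t = \<Delta> t + \<rho> / 2 * (norm (z (Suc t) - y t))\<^sup>2"
  by (simp add: \<Delta>_def L_def model_value_def)

lemma Delta_nonneg: "0 \<le> \<Delta> t"
  using order.trans[OF _ step_le_Delta[of t]] rho by simp

lemma model_gap_bounds: "\<Delta> t \<le> F (y t) - model_value t" "F (y t) - model_value t \<le> 2 * \<Delta> t"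
  using step_le_Delta[of t] rho unfolding model_gap by auto

text \<open>When the step is rejected, the true decrease misses a fraction \<open>1 - \<beta>\<close> of the predicted one, and this
  defect is the model error at \<open>z\<^sub>t\<^sub>+\<^sub>1\<close>.\<close>

lemma descent_or_null:
  "\<beta> * \<Delta> t \<le> F (y t) - F (y (Suc t)) \<or>
   y (Suc t) = y t \<and> (1 - \<beta>) * \<Delta> t \<le> F (z (Suc t)) - model_value t"
proof (cases "\<beta> * (F (y t) - model_value t) \<le> F (y t) - F (z (Suc t))")
  case True
  then have "y (Suc t) = z (Suc t)" by (simp add: y_Suc spectral_model_eq)
  moreover have "\<beta> * \<Delta> t \<le> \<beta> * (F (y t) - model_value t)"
    using beta model_gap_bounds(1)[of t] by simp
  ultimately show ?thesis using True by simp
next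
  case False
  then have "y (Suc t) = y t" by (simp add: y_Suc spectral_model_eq)
  moreover have "(1 - \<beta>) * \<Delta> t \<le> (1 - \<beta>) * (F (y t) - model_value t)"
    using beta model_gap_bounds(1)[of t] by (intro mult_left_mono) auto
  then have "(1 - \<beta>) * \<Delta> t \<le> F (z (Suc t)) - model_value t"
    using False by (simp add: left_diff_distrib)
  ultimately show ?thesis by blast
qed

lemma F_decreasing: "F (y (Suc t)) \<le> F (y t)"
  using descent_or_null[of t] mult_nonneg_nonneg[OF less_imp_le[OF beta(1)] Delta_nonneg[of t]] by auto

lemma F_le_start: "F (y t) \<le> F (y 0)"
  by (induction t) (use F_decreasing in \<open>auto intro: order.trans\<close>)

text \<open>Compare the saddle value with the value at the zero matrix, which belongs to every model:
  this leaves a constant and \<open>\<alpha>\<close> times the violation at \<open>y\<^sub>t\<close>, which is bounded as \<open>F(y\<^sub>t)\<close> decreases.\<close>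

lemma Delta_bounded:
  obtains D where "0 < D" "\<And>t. \<Delta> t \<le> D"
proof -
  obtain \<gamma> where \<gamma>: "0 < \<gamma>" "\<And>y. violation y \<le> \<gamma> * (F y - fopt)" using violation_le_gap by blast
  define D where "D = \<alpha> * (\<gamma> * (F (y 0) - fopt)) + (norm b)\<^sup>2 / (2 * \<rho>) + 1"
  have "\<Delta> t \<le> D" for t
  proof -
    define d where "d = z (Suc t) - y t"
    have "- (b \<bullet> z (Suc t)) + \<rho> / 2 * (norm d)\<^sup>2 \<le> L t (z (Suc t)) (X t)"
      using X_maximal[OF zero_in_model, of t] by (simp add: L_def d_def)
    moreover have "b \<bullet> z (Suc t) = b \<bullet> y t + b \<bullet> d" by (simp add: d_def inner_diff_right)
    moreover have "b \<bullet> d \<le> \<rho> / 2 * (norm d)\<^sup>2 + (norm b)\<^sup>2 / (2 * \<rho>)"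
    proof -
      have "0 \<le> (norm (\<rho> *\<^sub>R d - b))\<^sup>2 / (2 * \<rho>)" using rho by simp
      also have "(norm (\<rho> *\<^sub>R d - b))\<^sup>2 = \<rho>\<^sup>2 * (norm d)\<^sup>2 - 2 * \<rho> * (b \<bullet> d) + (norm b)\<^sup>2"
        unfolding power2_norm_eq_inner
        by (simp add: inner_diff_left inner_diff_right inner_commute[of d b] power2_eq_square algebra_simps)
      finally show ?thesis using rho by (simp add: add_divide_distrib diff_divide_distrib power2_eq_square)
    qed
    ultimately have "\<Delta> t \<le> \<alpha> * violation (y t) + (norm b)\<^sup>2 / (2 * \<rho>)"
      by (simp add: \<Delta>_def F_eq)
    moreover have "\<alpha> * violation (y t) \<le> \<alpha> * (\<gamma> * (F (y 0) - fopt))"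
    proof -
      have "violation (y t) \<le> \<gamma> * (F (y t) - fopt)" by (rule \<gamma>)
      also have "\<dots> \<le> \<gamma> * (F (y 0) - fopt)" using \<gamma>(1) F_le_start[of t] by simp
      finally show ?thesis using alpha_pos by simp
    qed
    ultimately show ?thesis by (simp add: D_def)
  qed
  moreover have "0 < D"
    unfolding D_def using alpha_pos \<gamma> F_ge_fopt[of "y 0"] rho by (intro add_nonneg_pos add_nonneg_nonneg) auto
  ultimately show ?thesis using that by blast
qed

text \<open>The prox centre does not move in a null step, so consecutive saddle values are values of one
  and the same function \<open>L t\<close>. The new one is at least its value at \<open>(1 - s) X\<^sub>t + s W\<close>, minimized over the
  first argument. There the linear term contributes \<open>s\<close> times the model error, and the change of
  gradient \<open>s (\<A> W - \<A> X\<^sub>t)\<close> costs a term of second order in \<open>s\<close>.\<close>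

lemma null_step_gain:
  assumes null: "y (Suc t) = y t" and s: "0 \<le> s" "s \<le> 1"
    and M: "\<And>Y. psd Y \<Longrightarrow> trace Y \<le> \<alpha> \<Longrightarrow> norm (A Y) \<le> M"
  shows "\<Delta> (Suc t) \<le> \<Delta> t - s * (F (z (Suc t)) - model_value t) + s\<^sup>2 * (2 * M)\<^sup>2 / (2 * \<rho>)"
proof -
  obtain W where W: "psd W" "trace W \<le> \<alpha>"
    "F (z (Suc t)) = - (b \<bullet> z (Suc t)) + W \<bullet> (At (z (Suc t)) - C)"
    and mem: "(1 - s) *\<^sub>R X t + s *\<^sub>R W \<in> model (Suc t)"
    using cut_in_next_model[of t] s by metis
  define w where "w = z (Suc (Suc t))"
  define d where "d = w - z (Suc t)"
  define h where "h = A W - A (X t)"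
  define G where "G = F (z (Suc t)) - model_value t"
  define v where "v = L t (z (Suc t)) (X t)"
  have LW: "L t w W = v + G + h \<bullet> d + \<rho> / 2 * (norm d)\<^sup>2"
  proof -
    have "A W - b + \<rho> *\<^sub>R (z (Suc t) - y t) = h" by (simp add: h_def flip: residual)
    moreover have "L t (z (Suc t)) W = v + G"
      using W(3) by (simp add: L_def v_def G_def model_value_def)
    ultimately show ?thesis
      using L_shift[OF psd_sym[OF W(1)], of t w "z (Suc t)"] by (simp add: d_def)
  qed
  have LX: "L t w (X t) = v + \<rho> / 2 * (norm d)\<^sup>2" unfolding v_def d_def by (rule L_X)
  have convex_comb: "e + ((1 - s) * f + s * g) + r = (1 - s) * (e + f + r) + s * (e + g + r)" for e f g r :: real
    by (simp add: algebra_simps)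
  have collect: "(1 - s) * (e + r) + s * (e + f + g + r) = e + s * f + s * g + r" for e f g r :: real
    by (simp add: algebra_simps)
  have "L t w ((1 - s) *\<^sub>R X t + s *\<^sub>R W) = (1 - s) * L t w (X t) + s * L t w W"
    unfolding L_def inner_add_left inner_scaleR_left by (rule convex_comb)
  also have "\<dots> = v + s * G + s * (h \<bullet> d) + \<rho> / 2 * (norm d)\<^sup>2"
    unfolding LW LX by (rule collect)
  finally have eq: "L t w ((1 - s) *\<^sub>R X t + s *\<^sub>R W) = v + s * G + s * (h \<bullet> d) + \<rho> / 2 * (norm d)\<^sup>2" .
  have "L (Suc t) w ((1 - s) *\<^sub>R X t + s *\<^sub>R W) \<le> L (Suc t) w (X (Suc t))"
    unfolding w_def by (rule X_maximal[OF mem])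
  then have "v + s * G + s * (h \<bullet> d) + \<rho> / 2 * (norm d)\<^sup>2 \<le> L (Suc t) w (X (Suc t))"
    using eq null by (simp add: L_def)
  moreover have "- (s\<^sup>2 * (norm h)\<^sup>2 / (2 * \<rho>)) \<le> s * (h \<bullet> d) + \<rho> / 2 * (norm d)\<^sup>2"
  proof -
    have "0 \<le> (norm (\<rho> *\<^sub>R d + s *\<^sub>R h))\<^sup>2 / (2 * \<rho>)" using rho by simp
    also have "(norm (\<rho> *\<^sub>R d + s *\<^sub>R h))\<^sup>2 = \<rho>\<^sup>2 * (norm d)\<^sup>2 + 2 * \<rho> * s * (h \<bullet> d) + s\<^sup>2 * (norm h)\<^sup>2"
      unfolding power2_norm_eq_inner
      by (simp add: inner_add_left inner_add_right inner_commute[of d h] power2_eq_square algebra_simps)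
    finally show ?thesis using rho by (simp add: add_divide_distrib power2_eq_square)
  qed
  moreover have "s\<^sup>2 * (norm h)\<^sup>2 / (2 * \<rho>) \<le> s\<^sup>2 * (2 * M)\<^sup>2 / (2 * \<rho>)"
  proof -
    have "norm h \<le> 2 * M"
      using norm_triangle_ineq4[of "A W" "A (X t)"] M[OF W(1,2)] M[OF X_psd X_trace, of t]
      by (simp add: h_def)
    then show ?thesis using rho
      by (intro divide_right_mono mult_left_mono power_mono) auto
  qed
  moreover have "\<Delta> (Suc t) = F (y t) - L (Suc t) w (X (Suc t))" by (simp add: \<Delta>_def null w_def)
  ultimately show ?thesis by (simp add: \<Delta>_def v_def G_def)
qed

text \<open>Choose \<open>s\<close> proportional to \<open>\<Delta>\<^sub>t\<close>; the factor \<open>s0\<close> keeps \<open>s \<le> 1\<close> and makes the second-order loss at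
  most half of the gain.\<close>

lemma null_step_contraction:
  obtains c where "0 < c"
    "\<And>t. y (Suc t) = y t \<Longrightarrow> (1 - \<beta>) * \<Delta> t \<le> F (z (Suc t)) - model_value t \<Longrightarrow>
       \<Delta> (Suc t) \<le> \<Delta> t - c * (\<Delta> t)\<^sup>2"
proof -
  obtain D where D: "0 < D" "\<And>t. \<Delta> t \<le> D" using Delta_bounded by blast
  obtain B where B: "0 < B" "\<And>Y. Y \<in> sym_mats \<Longrightarrow> norm (A Y) \<le> B * norm Y" using A_bounded by blast
  have M: "norm (A Y) \<le> B * \<alpha>" if "psd Y" "trace Y \<le> \<alpha>" for Y
    using B(2)[OF psd_sym[OF that(1)]] mult_left_mono[of "norm Y" \<alpha> B] B(1) psd_norm_le_trace[OF that(1)] that(2)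
    by linarith
  define H where "H = (2 * (B * \<alpha>))\<^sup>2 / \<rho>"
  have H: "0 \<le> H" using rho by (simp add: H_def)
  define q where "q = 1 - \<beta>"
  have q: "0 < q" using beta by (simp add: q_def)
  define s0 where "s0 = 1 / (q * D + H + 1)"
  have pos: "0 < q * D + H + 1" using q D H by (intro add_nonneg_pos add_nonneg_nonneg mult_nonneg_nonneg) auto
  then have s0: "0 < s0" by (simp add: s0_def)
  have s0D: "s0 * (q * D) \<le> 1" and s0H: "s0 * H \<le> 1"
    using pos q D H by (simp_all add: s0_def)
  have "\<Delta> (Suc t) \<le> \<Delta> t - (s0 * q\<^sup>2 / 2) * (\<Delta> t)\<^sup>2"
    if null: "y (Suc t) = y t" and big: "(1 - \<beta>) * \<Delta> t \<le> F (z (Suc t)) - model_value t" for t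
  proof -
    define g where "g = q * \<Delta> t"
    have g: "0 \<le> g" using q Delta_nonneg by (simp add: g_def)
    have "s0 * g \<le> s0 * (q * D)" using s0 q D(2)[of t] by (simp add: g_def)
    then have s1: "s0 * g \<le> 1" using s0D by linarith
    have "\<Delta> (Suc t) \<le> \<Delta> t - (s0 * g) * (F (z (Suc t)) - model_value t) + (s0 * g)\<^sup>2 * (2 * (B * \<alpha>))\<^sup>2 / (2 * \<rho>)"
      using s0 g s1 by (intro null_step_gain[OF null _ _ M]) auto
    also have "(s0 * g)\<^sup>2 * (2 * (B * \<alpha>))\<^sup>2 / (2 * \<rho>) = (s0 * H) * (s0 * g\<^sup>2) / 2"
      by (simp add: H_def power_mult_distrib power2_eq_square)
    also have "\<dots> \<le> 1 * (s0 * g\<^sup>2) / 2"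
      using s0H s0 by (intro divide_right_mono mult_right_mono) auto
    also have "\<Delta> t - (s0 * g) * (F (z (Suc t)) - model_value t) + 1 * (s0 * g\<^sup>2) / 2
        \<le> \<Delta> t - (s0 * g) * g + 1 * (s0 * g\<^sup>2) / 2"
      using big s0 g mult_left_mono[of g "F (z (Suc t)) - model_value t" "s0 * g"]
      by (simp add: g_def q_def)
    also have "\<dots> = \<Delta> t - (s0 * q\<^sup>2 / 2) * (\<Delta> t)\<^sup>2"
      by (simp add: g_def power2_eq_square field_simps)
    finally show ?thesis by simp
  qed
  moreover have "0 < s0 * q\<^sup>2 / 2" using s0 q by simp
  ultimately show ?thesis using that by blast
qed

text \<open>The saddle value is at most the Moreau envelope of \<open>F\<close> at \<open>y\<^sub>t\<close>, which is evaluated on the segment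
  towards a dual solution.\<close>

lemma Delta_ge:
  assumes "y' \<in> Ys" "0 \<le> s" "s \<le> 1"
  shows "s * (F (y t) - fopt) - \<rho> / 2 * s\<^sup>2 * (norm (y t - y'))\<^sup>2 \<le> \<Delta> t"
proof -
  define w where "w = y t + s *\<^sub>R (y' - y t)"
  have "L t (z (Suc t)) (X t) \<le> F w + \<rho> / 2 * (norm (w - y t))\<^sup>2"
    using z_minimal[of t w] L_le_F[OF X_psd X_trace, of t w t] by linarith
  moreover have "F w \<le> F (y t) - s * (F (y t) - fopt)"
    using F_segment[OF assms(2,3), of "y t" y'] assms(1) by (simp add: w_def Ys_iff)
  moreover have "(norm (w - y t))\<^sup>2 = s\<^sup>2 * (norm (y t - y'))\<^sup>2"
    by (simp add: w_def power_mult_distrib norm_minus_commute)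
  ultimately show ?thesis by (simp add: \<Delta>_def)
qed

text \<open>With a bounded distance to the solution, the step \<open>s = s0 \<delta>\<close> in the previous bound is optimal up
  to a constant.\<close>

lemma Delta_growth_general:
  obtains \<kappa> where "0 < \<kappa>" "\<And>t. \<kappa> * (F (y t) - fopt)\<^sup>2 \<le> \<Delta> t"
proof -
  obtain R where R: "0 < R" "\<And>u. F u \<le> F (y 0) \<Longrightarrow> norm u \<le> R" using sublevel_bounded by blast
  obtain y' where y': "y' \<in> Ys" using Ys_nonempty .
  define \<delta>0 where "\<delta>0 = F (y 0) - fopt"
  define r where "r = R + norm y'"
  define s0 where "s0 = 1 / (\<delta>0 + \<rho> * r\<^sup>2 + 1)"
  have \<delta>0: "0 \<le> \<delta>0" using F_ge_fopt by (simp add: \<delta>0_def)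
  have pos: "0 < \<delta>0 + \<rho> * r\<^sup>2 + 1" using \<delta>0 rho by (intro add_nonneg_pos add_nonneg_nonneg) auto
  have s0: "0 < s0" "s0 * \<delta>0 \<le> 1" "s0 * (\<rho> * r\<^sup>2) \<le> 1"
    using pos \<delta>0 rho by (simp_all add: s0_def)
  have "(s0 / 2) * (F (y t) - fopt)\<^sup>2 \<le> \<Delta> t" for t
  proof -
    define \<delta> where "\<delta> = F (y t) - fopt"
    have \<delta>: "0 \<le> \<delta>" "\<delta> \<le> \<delta>0" using F_ge_fopt[of "y t"] F_le_start[of t] by (auto simp: \<delta>_def \<delta>0_def)
    have "s0 * \<delta> \<le> s0 * \<delta>0" using \<delta> s0 by simp
    then have "s0 * \<delta> \<le> 1" using s0 by linarith
    then have "(s0 * \<delta>) * \<delta> - \<rho> / 2 * (s0 * \<delta>)\<^sup>2 * (norm (y t - y'))\<^sup>2 \<le> \<Delta> t"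
      using Delta_ge[OF y', of "s0 * \<delta>" t] s0 \<delta> by (simp add: \<delta>_def)
    moreover have "\<rho> / 2 * (s0 * \<delta>)\<^sup>2 * (norm (y t - y'))\<^sup>2 \<le> \<rho> / 2 * (s0 * \<delta>)\<^sup>2 * r\<^sup>2"
    proof -
      have "norm (y t - y') \<le> r"
        using norm_triangle_ineq4[of "y t" y'] R(2)[OF F_le_start, of t] by (simp add: r_def)
      then show ?thesis using rho by (intro mult_left_mono power_mono) auto
    qed
    moreover have "\<rho> / 2 * (s0 * \<delta>)\<^sup>2 * r\<^sup>2 = (s0 * (\<rho> * r\<^sup>2)) * (s0 * \<delta>\<^sup>2) / 2"
      by (simp add: power2_eq_square)
    moreover have "(s0 * (\<rho> * r\<^sup>2)) * (s0 * \<delta>\<^sup>2) / 2 \<le> 1 * (s0 * \<delta>\<^sup>2) / 2"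
      using s0 by (intro divide_right_mono mult_right_mono) auto
    moreover have "(s0 * \<delta>) * \<delta> = s0 * \<delta>\<^sup>2" by (simp add: power2_eq_square)
    ultimately have "s0 / 2 * \<delta>\<^sup>2 \<le> \<Delta> t" by linarith
    then show ?thesis by (simp only: \<delta>_def)
  qed
  then show ?thesis using that s0(1) by (metis half_gt_zero)
qed

text \<open>Quadratic growth makes the squared distance at most \<open>K \<delta>\<close>, so a constant step \<open>s0\<close> can be used.\<close>

lemma Delta_growth_strict:
  assumes "strict_complementarity C A b"
  obtains \<kappa> where "0 < \<kappa>" "\<And>t. \<kappa> * (F (y t) - fopt) \<le> \<Delta> t"
proof -
  obtain K where K: "0 < K"
    "\<And>u. F u \<le> F (y 0) \<Longrightarrow> \<exists>y'\<in>Ys. (norm (u - y'))\<^sup>2 \<le> K * (F u - fopt)"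
    using quadratic_growth[OF assms, of "F (y 0)"] by blast
  define s0 where "s0 = 1 / (\<rho> * K + 1)"
  have pos: "0 < \<rho> * K + 1" using K rho by (simp add: add_pos_pos)
  have s0: "0 < s0" "s0 \<le> 1" "s0 * (\<rho> * K) \<le> 1"
    using pos K rho by (simp_all add: s0_def)
  have "(s0 / 2) * (F (y t) - fopt) \<le> \<Delta> t" for t
  proof -
    define \<delta> where "\<delta> = F (y t) - fopt"
    have \<delta>: "0 \<le> \<delta>" using F_ge_fopt[of "y t"] by (auto simp: \<delta>_def)
    obtain y' where y': "y' \<in> Ys" "(norm (y t - y'))\<^sup>2 \<le> K * \<delta>"
      using K(2)[OF F_le_start[of t]] by (auto simp: \<delta>_def)
    have "s0 * \<delta> - \<rho> / 2 * s0\<^sup>2 * (norm (y t - y'))\<^sup>2 \<le> \<Delta> t"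
      using Delta_ge[OF y'(1), of s0 t] s0 by (simp add: \<delta>_def)
    moreover have "\<rho> / 2 * s0\<^sup>2 * (norm (y t - y'))\<^sup>2 \<le> \<rho> / 2 * s0\<^sup>2 * (K * \<delta>)"
      using rho y'(2) by (intro mult_left_mono) auto
    moreover have "\<rho> / 2 * s0\<^sup>2 * (K * \<delta>) = (s0 * (\<rho> * K)) * (s0 * \<delta>) / 2"
      by (simp add: power2_eq_square)
    moreover have "(s0 * (\<rho> * K)) * (s0 * \<delta>) / 2 \<le> 1 * (s0 * \<delta>) / 2"
      using s0 \<delta> by (intro divide_right_mono mult_right_mono) auto
    ultimately have "s0 / 2 * \<delta> \<le> \<Delta> t" by linarith
    then show ?thesis by (simp only: \<delta>_def)
  qed
  then show ?thesis using that s0(1) by (metis half_gt_zero)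
qed

text \<open>The residual enters the primal-dual gap without being squared, so accuracy \<open>q\<^sup>2 \<epsilon>\<close> yields a gap of
  order \<open>q \<epsilon>\<^sup>1\<^sup>/\<^sup>2\<close>; the constant \<open>q\<close> is chosen small enough to absorb all the factors.\<close>

lemma eps_optimal_if_small:
  obtains q where "0 < q" "q \<le> 1"
    "\<And>t \<epsilon>. 0 < \<epsilon> \<Longrightarrow> \<epsilon> < 1/2 \<Longrightarrow> F (y t) - fopt \<le> q * \<epsilon> \<Longrightarrow> \<beta> * \<Delta> t \<le> q * \<epsilon> \<Longrightarrow>
       eps_optimal_pair C A b \<alpha> \<epsilon> (X t) (y t)"
proof -
  obtain \<gamma> where \<gamma>: "0 < \<gamma>" "\<And>y. violation y \<le> \<gamma> * (F y - fopt)" using violation_le_gap by blast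
  obtain R where R: "0 < R" "\<And>u. F u \<le> F (y 0) \<Longrightarrow> norm u \<le> R" using sublevel_bounded by blast
  obtain D where D: "0 < D" "\<And>t. \<Delta> t \<le> D" using Delta_bounded by blast
  define Rz where "Rz = R + sqrt (2 * D / \<rho>)"
  define H where "H = 2 / \<beta> + \<alpha> * \<gamma> + sqrt (2 * \<rho> / \<beta>) * Rz"
  define q where "q = 1 / (1 + 2 * \<rho> / \<beta> + \<gamma> + H)"
  have Rz: "0 \<le> Rz" using R D rho by (simp add: Rz_def)
  have H: "0 \<le> H" using beta alpha_pos \<gamma> Rz rho by (simp add: H_def)
  have pos: "0 < 1 + 2 * \<rho> / \<beta> + \<gamma> + H" using H \<gamma> rho beta by (intro add_pos_nonneg) auto
  have "0 \<le> 2 * \<rho> / \<beta>" using rho beta by simp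
  then have q: "0 < q" "q \<le> 1" "2 * \<rho> / \<beta> * q \<le> 1" "\<gamma> * q \<le> 1" "H * q \<le> 1"
    using pos H \<gamma>(1) unfolding q_def times_divide_eq_right mult_1_right
    by (simp_all only: pos_divide_le_eq mult_1 zero_less_divide_1_iff)
  have q2: "q\<^sup>2 \<le> q" using q by (simp add: power2_eq_square mult_left_le)
  have main: "eps_optimal_pair C A b \<alpha> \<epsilon> (X t) (y t)"
    if eps: "0 < \<epsilon>" "\<epsilon> < 1/2" and small: "F (y t) - fopt \<le> q\<^sup>2 * \<epsilon>" "\<beta> * \<Delta> t \<le> q\<^sup>2 * \<epsilon>" for t \<epsilon>
  proof -
    have q2eps: "q\<^sup>2 * \<epsilon> \<le> q * \<epsilon>" using q2 eps by simp
    have F1: "F (y t) - fopt \<le> \<epsilon>"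
    proof -
      have "q * \<epsilon> \<le> 1 * \<epsilon>" using q eps by (intro mult_right_mono) auto
      then show ?thesis using small q2eps by linarith
    qed
    have Dt: "\<Delta> t \<le> q\<^sup>2 * \<epsilon> / \<beta>" using small(2) beta by (simp add: field_simps)
    have res2: "(norm (b - A (X t)))\<^sup>2 \<le> 2 * \<rho> / \<beta> * (q\<^sup>2 * \<epsilon>)"
    proof -
      have "(norm (b - A (X t)))\<^sup>2 = 2 * \<rho> * (\<rho> / 2 * (norm (z (Suc t) - y t))\<^sup>2)"
        unfolding residual by (simp add: power_mult_distrib power2_eq_square)
      also have "\<dots> \<le> 2 * \<rho> * (q\<^sup>2 * \<epsilon> / \<beta>)"
        using order.trans[OF step_le_Delta Dt] rho by (intro mult_left_mono) auto
      finally show ?thesis by simp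
    qed
    have res: "(norm (b - A (X t)))\<^sup>2 \<le> \<epsilon>"
    proof -
      have "2 * \<rho> / \<beta> * (q\<^sup>2 * \<epsilon>) \<le> 2 * \<rho> / \<beta> * (q * \<epsilon>)"
        using q2eps rho beta by (intro mult_left_mono) auto
      also have "\<dots> = (2 * \<rho> / \<beta> * q) * \<epsilon>" by simp
      also have "\<dots> \<le> 1 * \<epsilon>" using q(3) eps by (intro mult_right_mono) auto
      finally show ?thesis using res2 by simp
    qed
    have viol: "violation (y t) \<le> \<gamma> * (q\<^sup>2 * \<epsilon>)"
      using \<gamma>(2)[of "y t"] mult_left_mono[OF small(1), of \<gamma>] \<gamma>(1) by linarith
    have "\<gamma> * (q\<^sup>2 * \<epsilon>) \<le> \<gamma> * (q * \<epsilon>)" using q2eps \<gamma>(1) by simp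
    also have "\<dots> = (\<gamma> * q) * \<epsilon>" by simp
    also have "\<dots> \<le> 1 * \<epsilon>" using q(4) eps by (intro mult_right_mono) auto
    finally have viol1: "violation (y t) \<le> \<epsilon>" using viol by linarith
    have gap: "\<bar>b \<bullet> y t - C \<bullet> X t\<bar> \<le> sqrt \<epsilon>"
    proof -
      have id: "b \<bullet> y t - C \<bullet> X t
          = \<alpha> * violation (y t) - (F (y t) - model_value t) + (b - A (X t)) \<bullet> z (Suc t)"
        using At_inner[OF psd_sym[OF X_psd], of t "z (Suc t)"]
        by (simp add: F_eq model_value_def inner_diff_right inner_diff_left inner_commute[of C "X t"])
      have t1: "\<alpha> * violation (y t) \<le> \<alpha> * \<gamma> * (q\<^sup>2 * \<epsilon>)"
        using mult_left_mono[OF viol, of \<alpha>] alpha_pos by simp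
      have t2: "F (y t) - model_value t \<le> 2 / \<beta> * (q\<^sup>2 * \<epsilon>)"
        using model_gap_bounds(2)[of t] Dt by simp
      have t3: "\<bar>(b - A (X t)) \<bullet> z (Suc t)\<bar> \<le> sqrt (2 * \<rho> / \<beta>) * (q * sqrt \<epsilon>) * Rz"
      proof -
        have "norm (b - A (X t)) \<le> sqrt (2 * \<rho> / \<beta> * (q\<^sup>2 * \<epsilon>))" using res2 by (rule real_le_rsqrt)
        also have "\<dots> = sqrt (2 * \<rho> / \<beta>) * (q * sqrt \<epsilon>)" 
          using q(1) unfolding real_sqrt_mult by simp
        finally have n1: "norm (b - A (X t)) \<le> sqrt (2 * \<rho> / \<beta>) * (q * sqrt \<epsilon>)" .
        have "norm (z (Suc t) - y t) \<le> sqrt (2 * D / \<rho>)"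
          using step_le_Delta[of t] D(2)[of t] rho by (intro real_le_rsqrt) (simp add: field_simps)
        then have n2: "norm (z (Suc t)) \<le> Rz"
          using norm_triangle_sub[of "z (Suc t)" "y t"] R(2)[OF F_le_start, of t] by (simp add: Rz_def)
        have "\<bar>(b - A (X t)) \<bullet> z (Suc t)\<bar> \<le> norm (b - A (X t)) * norm (z (Suc t))"
          by (rule Cauchy_Schwarz_ineq2)
        also have "\<dots> \<le> sqrt (2 * \<rho> / \<beta>) * (q * sqrt \<epsilon>) * Rz"
          using n1 n2 q eps rho beta by (intro mult_mono) auto
        finally show ?thesis .
      qed
      have "\<epsilon> \<le> sqrt \<epsilon>" using eps by (intro real_le_rsqrt) (simp add: power2_eq_square)
      then have e1: "q\<^sup>2 * \<epsilon> \<le> q * sqrt \<epsilon>" using q2 q eps by (intro mult_mono) auto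
      have "\<bar>b \<bullet> y t - C \<bullet> X t\<bar>
          \<le> \<alpha> * \<gamma> * (q\<^sup>2 * \<epsilon>) + 2 / \<beta> * (q\<^sup>2 * \<epsilon>) + sqrt (2 * \<rho> / \<beta>) * (q * sqrt \<epsilon>) * Rz"
      proof -
        have "0 \<le> \<alpha> * violation (y t)" using alpha_pos violation_nonneg by simp
        moreover have "0 \<le> F (y t) - model_value t"
          using model_gap_bounds(1)[of t] Delta_nonneg[of t] by linarith
        ultimately show ?thesis unfolding id using t1 t2 t3 by linarith
      qed
      also have "\<dots> \<le> \<alpha> * \<gamma> * (q * sqrt \<epsilon>) + 2 / \<beta> * (q * sqrt \<epsilon>) + sqrt (2 * \<rho> / \<beta>) * (q * sqrt \<epsilon>) * Rz"
        using e1 alpha_pos \<gamma>(1) beta by (intro add_mono mult_left_mono order.refl) auto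
      also have "\<dots> = (H * q) * sqrt \<epsilon>" by (simp add: H_def algebra_simps)
      also have "\<dots> \<le> 1 * sqrt \<epsilon>" using q(5) eps by (intro mult_right_mono) auto
      finally show ?thesis by simp
    qed
    show ?thesis
      unfolding eps_optimal_pair_def
      using F1 res X_psd gap viol1 lambda_min_slack[of "y t"] by (auto simp: Ys_iff)
  qed
  have "0 < q\<^sup>2" "q\<^sup>2 \<le> 1" using q q2 by auto
  then show ?thesis using that main by blast
qed

lemma iteration_bound:
  assumes k: "1 \<le> k" and \<kappa>: "0 < \<kappa>" "\<And>t. \<kappa> * (F (y t) - fopt) ^ k \<le> \<Delta> t"
  shows "\<exists>K. \<forall>\<epsilon>. 0 < \<epsilon> \<and> \<epsilon> < 1/2 \<longrightarrow>
    (\<exists>t. real t \<le> K / \<epsilon> ^ (2 * k - 1) \<and> eps_optimal_pair C A b \<alpha> \<epsilon> (X t) (y t))"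
proof -
  obtain c where c: "0 < c"
    "\<And>t. y (Suc t) = y t \<Longrightarrow> (1 - \<beta>) * \<Delta> t \<le> F (z (Suc t)) - model_value t \<Longrightarrow>
       \<Delta> (Suc t) \<le> \<Delta> t - c * (\<Delta> t)\<^sup>2"
    using null_step_contraction by blast
  obtain q where q: "0 < q" "q \<le> 1"
    "\<And>t \<epsilon>. 0 < \<epsilon> \<Longrightarrow> \<epsilon> < 1/2 \<Longrightarrow> F (y t) - fopt \<le> q * \<epsilon> \<Longrightarrow> \<beta> * \<Delta> t \<le> q * \<epsilon> \<Longrightarrow>
       eps_optimal_pair C A b \<alpha> \<epsilon> (X t) (y t)"
    using eps_optimal_if_small by blast
  have step: "\<beta> * \<Delta> t \<le> (F (y t) - fopt) - (F (y (Suc t)) - fopt) \<or>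
      F (y (Suc t)) - fopt = F (y t) - fopt \<and> \<Delta> (Suc t) \<le> \<Delta> t - c * (\<Delta> t)\<^sup>2" for t
    using descent_or_null[of t] c(2)[of t] by auto
  have nonneg: "0 \<le> F (y t) - fopt" for t using F_ge_fopt by simp
  obtain K where K: "\<And>\<epsilon>. 0 < \<epsilon> \<Longrightarrow> \<epsilon> \<le> 1 \<Longrightarrow>
      \<exists>t. real t \<le> K / \<epsilon> ^ (2 * k - 1) \<and> F (y t) - fopt \<le> \<epsilon> \<and> \<beta> * \<Delta> t \<le> \<epsilon>"
    using bundle_rate[where \<delta> = "\<lambda>t. F (y t) - fopt", OF beta(1) c(1) \<kappa>(1) k nonneg step \<kappa>(2)]
    by blast
  show ?thesis
  proof (intro exI[of _ "K / q ^ (2 * k - 1)"] allI impI)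
    fix \<epsilon> :: real assume eps: "0 < \<epsilon> \<and> \<epsilon> < 1/2"
    have "q * \<epsilon> \<le> 1 * 1" using q eps by (intro mult_mono) auto
    then obtain t where t: "real t \<le> K / (q * \<epsilon>) ^ (2 * k - 1)"
      "F (y t) - fopt \<le> q * \<epsilon>" "\<beta> * \<Delta> t \<le> q * \<epsilon>"
      using K[of "q * \<epsilon>"] q eps by auto
    then show "\<exists>t. real t \<le> K / q ^ (2 * k - 1) / \<epsilon> ^ (2 * k - 1) \<and> eps_optimal_pair C A b \<alpha> \<epsilon> (X t) (y t)"
      using q(3)[of \<epsilon> t] eps by (intro exI[of _ t]) (auto simp: power_mult_distrib)
  qed
qed

end

section \<open>Iteration complexity\<close>

theorem theorem3p1:
  fixes C :: "real^'n^'n" and A :: "real^'n^'n \<Rightarrow> real^'m" and b :: "real^'m"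
    and rp rc :: nat and \<beta> \<rho> \<alpha> :: real
    and V0 :: "real^'r^'n" and y0 :: "real^'m"
    and y z :: "nat \<Rightarrow> real^'m" and Xbar X :: "nat \<Rightarrow> real^'n^'n"
    and V :: "nat \<Rightarrow> real^'r^'n" and p :: "nat \<Rightarrow> real \<times> (real^'r^'r)"
  assumes "C \<in> sym_mats" and "linear_on_sym A"
    and "strong_duality C A b"
    and "rc \<ge> 1" and "CARD('r) = rp + rc"
    and "0 < \<beta>" and "\<beta> < 1" and "\<rho> > 0"
    and "\<alpha> > (SUP X\<in>primal_solutions C A b. trace X)"
    and "\<alpha> \<ge> 2 * primal_radius C A b"
    and "orthonormal_columns V0"
    and "specbm_run C A b rp rc \<beta> \<rho> \<alpha> V0 y0 y z Xbar V p X"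
  shows "(\<exists>K. \<forall>\<epsilon>. 0 < \<epsilon> \<and> \<epsilon> < 1/2 \<longrightarrow>
            (\<exists>t. real t \<le> K / \<epsilon>^3 \<and> eps_optimal_pair C A b \<alpha> \<epsilon> (X t) (y t)))
       \<and> (strict_complementarity C A b \<longrightarrow>
          (\<exists>K'. \<forall>\<epsilon>. 0 < \<epsilon> \<and> \<epsilon> < 1/2 \<longrightarrow>
            (\<exists>t. real t \<le> K' / \<epsilon> \<and> eps_optimal_pair C A b \<alpha> \<epsilon> (X t) (y t))))"
proof -
  interpret specbm C A b \<alpha> rp rc \<beta> \<rho> V0 y0 y z Xbar X V p
    using assms by unfold_locales auto
  show ?thesis
  proof (intro conjI impI)
    obtain \<kappa> where "0 < \<kappa>" "\<And>t. \<kappa> * (F (y t) - fopt) ^ 2 \<le> \<Delta> t"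
      using Delta_growth_general by blast
    from iteration_bound[OF _ this]
    show "\<exists>K. \<forall>\<epsilon>. 0 < \<epsilon> \<and> \<epsilon> < 1/2 \<longrightarrow>
        (\<exists>t. real t \<le> K / \<epsilon>^3 \<and> eps_optimal_pair C A b \<alpha> \<epsilon> (X t) (y t))"
      by simp
  next
    assume "strict_complementarity C A b"
    then obtain \<kappa> where "0 < \<kappa>" "\<And>t. \<kappa> * (F (y t) - fopt) \<le> \<Delta> t"
      using Delta_growth_strict by blast
    then show "\<exists>K. \<forall>\<epsilon>. 0 < \<epsilon> \<and> \<epsilon> < 1/2 \<longrightarrow>
        (\<exists>t. real t \<le> K / \<epsilon> \<and> eps_optimal_pair C A b \<alpha> \<epsilon> (X t) (y t))"
      using iteration_bound[of 1 \<kappa>] by simp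
  qed
qed

end
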